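(* Let $n$ be a prime number, let $m$ be a positive integer, let $p_1,\dots,p_m\in\mathbb{Z}^{+}$, let $P^m=(p_1,p_2,\dots,p_m)$ be a pretzel link, and let $\mathbb{Z}_n$ be the dihedral quandle. Put $$h=\sum_{1\le i_1<i_2<\dots<i_{m-1}\le m}p_{i_1}p_{i_2}\cdots p_{i_{m-1}}.$$ Then, with all congruences modulo $n$, the quandle coloring quiver $\mathcal{Q}_{\mathbb{Z}_n}(P^m)$ is given as follows. - It is $(\overleftrightarrow{K_n},\hat n)$ if $h\not\equiv 0$. - It is $(\overleftrightarrow{K_n},\hat n)\overleftarrow{\nabla}_{\hat 1}(\overleftrightarrow{K_{(n-1)n}},\hat 1)$ if $h\equiv 0$ and the congruences $p_{i_1}p_{i_2}\cdots p_{i_{m-2}}\equiv 0$ with $1\le i_1<\dots<i_{m-2}\le m$ (that is, $p_1\cdots p_{m-2}\equiv\dots\equiv p_3\cdots p_m\equiv 0$) do not all hold. - In the intermediate cases, for each integer $j$ with $2\le j\le m-3$, it is $(\overleftrightarrow{K_n},\hat n)\overleftarrow{\nabla}_{\hat 1}\Big[\bigsqcup_{\frac{n^{m-j}-n}{n(n-1)}}(\overleftrightarrow{K_{n(n-1)}},\hat 1)\Big]$ if $h\equiv 0$ and exactly $j$ of $p_1,\dots,p_m$ are coprime with $n$ while the rest are multiples of $n$. - It is $(\overleftrightarrow{K_n},\hat n)\overleftarrow{\nabla}_{\hat 1}\Big[\bigsqcup_{\frac{n^{m-1}-n}{n(n-1)}}(\overleftrightarrow{K_{n(n-1)}},\hat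 1)\Big]$ if among $p_1,\dots,p_m$ only one is coprime with $n$. - It is $(\overleftrightarrow{K_n},\hat n)\overleftarrow{\nabla}_{\hat 1}\Big[\bigsqcup_{\frac{n^{m}-n}{n(n-1)}}(\overleftrightarrow{K_{n(n-1)}},\hat 1)\Big]$ if $p_1\equiv p_2\equiv\dots\equiv p_m\equiv 0$.
   Context: A quandle is a set $X$ with a binary operation $\triangleright$ such that $x\triangleright x=x$ for all $x$; for each $y$ the map $x\mapsto x\triangleright y$ is invertible; and $(x\triangleright y)\triangleright z=(x\triangleright z)\triangleright(y\triangleright z)$ for all $x,y,z$. A quandle homomorphism $f$ satisfies $f(x\triangleright y)=f(x)\triangleright f(y)$. The dihedral quandle $\mathbb{Z}_n$ is the set of integers modulo $n$ with $x\triangleright y=2y-x \pmod n$. For an oriented link $K$ with diagram $D$, the fundamental quandle $\mathcal{Q}(K)$ is the quandle generated by the arcs of $D$ with one relation per crossing: if the overcrossing arc is $y$ (pointing up), and $x$ is the undercrossing arc on the right of $y$, then the undercrossing arc on the left of $y$ is $x\triangleright y$. $\mathrm{Hom}(\mathcal{Q}(K),X)$ is the set of quandle homomorphisms (colorings of $K$ by $X$). Pretzel link: for a positive integer $m$ and nonzero integers $p_1,\dots,p_m$, the pretzel link $(p_1,\dots,p_m)$ (an $m$-pretzel link) is formed from $m$ tangles $A_1,\dots,A_m$ placed side by side, where $A_i$ is a vertical column of two strands twisted about each other with $|p_i|$ crossings, all of one fixed handedness if $p_i>0$ ("positive") and all of the opposite handedness if $p_i<0$ ("negative"). The NE endpoint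 of $A_i$ is joined to the NW endpoint of $A_{i+1}$, the SE endpoint of $A_i$ to the SW endpoint of $A_{i+1}$, and the outer endpoints are closed up by joining the NW (resp. SW) endpoint of $A_1$ to the NE (resp. SE) endpoint of $A_m$. Any orientation of the link may be chosen. Full quandle coloring quiver: for a finite quandle $X$ and oriented link $L$, $\mathcal{Q}_X(L)$ is the directed graph (loops and multiple edges allowed) with one vertex for each $f\in\mathrm{Hom}(\mathcal{Q}(L),X)$ and, for each quandle endomorphism $\phi\in\mathrm{Hom}(X,X)$ with $g=\phi\circ f$, one edge from $f$ to $g$. Equalities of quivers are understood up to isomorphism. Graph notation: a directed pseudograph is a vertex set $V$ with a weight function $c:V\times V\to\mathbb{N}\cup\{0\}$, $c(x,y)$ being the number of edges from $x$ to $y$ (loops allowed). $(\overleftrightarrow{K_N},\hat k)$ is the directed pseudograph with $N$ vertices and $c(x,y)=k$ for all $x,y\in V$ (including $x=y$). For graphs $G_1,G_2$ with disjoint vertex and edge sets, $G_1\overleftarrow{\nabla}_{\hat c}G_2$ is the graph consisting of $G_1$, $G_2$ and $c$ additional edges directed from every vertex of $G_2$ to every vertex of $G_1$. $\bigsqcup_k G$ is the disjoint union of $k$ copies of $G$. *)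

theory Defs
  imports Main "HOL-Library.FuncSet" "HOL-Number_Theory.Cong"
begin

section \<open>Quandles\<close>

record 'a quandle =
  carrier :: "'a set"
  qop :: "'a \<Rightarrow> 'a \<Rightarrow> 'a"

definition is_quandle :: "'a quandle \<Rightarrow> bool" where
  "is_quandle X \<longleftrightarrow>
     (\<forall>x\<in>carrier X. \<forall>y\<in>carrier X. qop X x y \<in> carrier X) \<and>
     (\<forall>x\<in>carrier X. qop X x x = x) \<and>
     (\<forall>y\<in>carrier X. bij_betw (\<lambda>x. qop X x y) (carrier X) (carrier X)) \<and>
     (\<forall>x\<in>carrier X. \<forall>y\<in>carrier X. \<forall>z\<in>carrier X.
        qop X (qop X x y) z = qop X (qop X x z) (qop X y z))"

text \<open>Homomorphisms are taken to be undefined outside the carrier, so that distinct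
  elements of this set are distinct as maps on the carrier.\<close>

definition quandle_hom :: "'a quandle \<Rightarrow> 'b quandle \<Rightarrow> ('a \<Rightarrow> 'b) set" where
  "quandle_hom X Y =
     {f \<in> carrier X \<rightarrow>\<^sub>E carrier Y.
        \<forall>x\<in>carrier X. \<forall>y\<in>carrier X. f (qop X x y) = qop Y (f x) (f y)}"

definition dihedral_quandle :: "nat \<Rightarrow> int quandle" where
  "dihedral_quandle n =
     \<lparr>carrier = {0..<int n}, qop = (\<lambda>x y. (2 * y - x) mod int n)\<rparr>"

lemma is_quandle_dihedral: "is_quandle (dihedral_quandle n)"
proof -
  have inv: "(2 * y - (2 * y - x) mod int n) mod int n = x"
    if "x \<in> {0..<int n}" for x y
  proof -
    have "(2 * y - (2 * y - x) mod int n) mod int n = x mod int n"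
      by (simp add: mod_diff_right_eq)
    with that show ?thesis by simp
  qed
  have bij: "bij_betw (\<lambda>x. (2 * y - x) mod int n) {0..<int n} {0..<int n}" for y
    by (rule bij_betwI[where g = "\<lambda>x. (2 * y - x) mod int n"]) (auto simp: inv)
  have dist: "(2 * z - (2 * y - x) mod int n) mod int n =
      (2 * ((2 * z - y) mod int n) - (2 * z - x) mod int n) mod int n" for x y z
  proof -
    have "(2 * ((2 * z - y) mod int n) - (2 * z - x) mod int n) mod int n
        = (2 * ((2 * z - y) mod int n) mod int n - (2 * z - x) mod int n) mod int n"
      by (rule mod_diff_left_eq[symmetric])
    also have "\<dots> = (2 * (2 * z - y) mod int n - (2 * z - x) mod int n) mod int n"
      by (simp only: mod_mult_right_eq)
    also have "\<dots> = (2 * (2 * z - y) - (2 * z - x)) mod int n"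
      by (rule mod_diff_eq)
    also have "2 * (2 * z - y) - (2 * z - x) = 2 * z - (2 * y - x)"
      by simp
    finally show ?thesis by (simp add: mod_diff_right_eq)
  qed
  show ?thesis
    unfolding is_quandle_def dihedral_quandle_def using bij dist by auto
qed


section \<open>Quandles given by generators and relations\<close>

text \<open>In \<open>Inv s t\<close> the inverse of the right translation by \<open>t\<close> is applied to \<open>s\<close>.\<close>

datatype 'g qterm = Gen 'g | Op "'g qterm" "'g qterm" | Inv "'g qterm" "'g qterm"

definition qterms :: "'g set \<Rightarrow> 'g qterm set" where
  "qterms G = {t. set_qterm t \<subseteq> G}"

inductive_set pres_eq :: "'g set \<Rightarrow> ('g qterm \<times> 'g qterm) set \<Rightarrow> ('g qterm \<times> 'g qterm) set"
  for G R where
  relator: "(s, t) \<in> R \<Longrightarrow> s \<in> qterms G \<Longrightarrow> t \<in> qterms G \<Longrightarrow> (s, t) \<in> pres_eq G R"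
| idem: "t \<in> qterms G \<Longrightarrow> (Op t t, t) \<in> pres_eq G R"
| op_inv: "s \<in> qterms G \<Longrightarrow> t \<in> qterms G \<Longrightarrow> (Op (Inv s t) t, s) \<in> pres_eq G R"
| inv_op: "s \<in> qterms G \<Longrightarrow> t \<in> qterms G \<Longrightarrow> (Inv (Op s t) t, s) \<in> pres_eq G R"
| distrib: "s \<in> qterms G \<Longrightarrow> t \<in> qterms G \<Longrightarrow> u \<in> qterms G \<Longrightarrow>
    (Op (Op s t) u, Op (Op s u) (Op t u)) \<in> pres_eq G R"
| cong_Op: "(s, s') \<in> pres_eq G R \<Longrightarrow> (t, t') \<in> pres_eq G R \<Longrightarrow>
    (Op s t, Op s' t') \<in> pres_eq G R"
| cong_Inv: "(s, s') \<in> pres_eq G R \<Longrightarrow> (t, t') \<in> pres_eq G R \<Longrightarrow>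
    (Inv s t, Inv s' t') \<in> pres_eq G R"
| refl: "t \<in> qterms G \<Longrightarrow> (t, t) \<in> pres_eq G R"
| sym: "(s, t) \<in> pres_eq G R \<Longrightarrow> (t, s) \<in> pres_eq G R"
| trans: "(s, t) \<in> pres_eq G R \<Longrightarrow> (t, u) \<in> pres_eq G R \<Longrightarrow> (s, u) \<in> pres_eq G R"

definition presented_quandle ::
  "'g set \<Rightarrow> ('g qterm \<times> 'g qterm) set \<Rightarrow> 'g qterm set quandle" where
  "presented_quandle G R =
     \<lparr>carrier = qterms G // pres_eq G R,
      qop = (\<lambda>A B. \<Union>s\<in>A. \<Union>t\<in>B. pres_eq G R `` {Op s t})\<rparr>"

lemma qterms_simps [simp]:
  "Gen g \<in> qterms G \<longleftrightarrow> g \<in> G"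
  "Op s t \<in> qterms G \<longleftrightarrow> s \<in> qterms G \<and> t \<in> qterms G"
  "Inv s t \<in> qterms G \<longleftrightarrow> s \<in> qterms G \<and> t \<in> qterms G"
  by (auto simp: qterms_def)

lemma pres_eq_qterms:
  "(s, t) \<in> pres_eq G R \<Longrightarrow> s \<in> qterms G \<and> t \<in> qterms G"
  by (induction rule: pres_eq.induct) auto

lemma equiv_pres_eq: "equiv (qterms G) (pres_eq G R)"
proof (rule equivI)
  show "pres_eq G R \<subseteq> qterms G \<times> qterms G" using pres_eq_qterms by auto
  show "refl_on (qterms G) (pres_eq G R)" by (simp add: refl_on_def pres_eq.refl)
  show "sym (pres_eq G R)" by (rule symI) (rule pres_eq.sym)
  show "trans (pres_eq G R)" by (rule transI) (rule pres_eq.trans)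
qed

lemma qop_presented_quandle:
  assumes "s \<in> qterms G" "t \<in> qterms G"
  shows "qop (presented_quandle G R) (pres_eq G R `` {s}) (pres_eq G R `` {t}) =
    pres_eq G R `` {Op s t}"
proof -
  let ?c = "\<lambda>t. pres_eq G R `` {t}"
  have "?c (Op s' t') = ?c (Op s t)" if "s' \<in> ?c s" "t' \<in> ?c t" for s' t'
    by (rule equiv_class_eq[OF equiv_pres_eq, symmetric])
      (use that in \<open>auto intro: pres_eq.cong_Op\<close>)
  then have "(\<Union>s'\<in>?c s. \<Union>t'\<in>?c t. ?c (Op s' t')) =
      (\<Union>s'\<in>?c s. \<Union>t'\<in>?c t. ?c (Op s t))"
    by (intro SUP_cong HOL.refl) simp
  moreover have "s \<in> ?c s" "t \<in> ?c t"
    using assms by (auto intro: pres_eq.refl)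
  then have "(\<Union>s'\<in>?c s. \<Union>t'\<in>?c t. ?c (Op s t)) = ?c (Op s t)"
    by blast
  ultimately show ?thesis
    by (simp add: presented_quandle_def)
qed

lemma is_quandle_presented: "is_quandle (presented_quandle G R)"
proof -
  let ?Q = "presented_quandle G R" and ?E = "pres_eq G R"
  let ?c = "\<lambda>t. ?E `` {t}"
  note eqI = equiv_class_eq[OF equiv_pres_eq]
  have carr: "carrier ?Q = ?c ` qterms G"
    by (auto simp: presented_quandle_def quotient_def)
  have bij: "bij_betw (\<lambda>x. qop ?Q x (?c t)) (carrier ?Q) (carrier ?Q)"
    if t: "t \<in> qterms G" for t
    unfolding bij_betw_def
  proof
    show "inj_on (\<lambda>x. qop ?Q x (?c t)) (carrier ?Q)"
    proof (rule inj_onI)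
      fix x y assume "x \<in> carrier ?Q" "y \<in> carrier ?Q"
        and eq: "qop ?Q x (?c t) = qop ?Q y (?c t)"
      then obtain a b where ab: "a \<in> qterms G" "b \<in> qterms G" "x = ?c a" "y = ?c b"
        by (auto simp: carr)
      with eq t have "?c (Op a t) = ?c (Op b t)" by (simp add: qop_presented_quandle)
      from eq_equiv_class[OF this equiv_pres_eq] ab t have "(Op a t, Op b t) \<in> ?E"
        by simp
      then have "(Inv (Op a t) t, Inv (Op b t) t) \<in> ?E"
        using t by (auto intro: pres_eq.cong_Inv pres_eq.refl)
      then have "(a, b) \<in> ?E"
        using pres_eq.trans[OF pres_eq.sym[OF pres_eq.inv_op]
          pres_eq.trans[OF _ pres_eq.inv_op]] ab t by blast
      then show "x = y" unfolding ab(3,4) by (rule eqI)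
    qed
    show "(\<lambda>x. qop ?Q x (?c t)) ` carrier ?Q = carrier ?Q"
    proof
      show "(\<lambda>x. qop ?Q x (?c t)) ` carrier ?Q \<subseteq> carrier ?Q"
        using t by (auto simp: carr qop_presented_quandle)
      show "carrier ?Q \<subseteq> (\<lambda>x. qop ?Q x (?c t)) ` carrier ?Q"
      proof
        fix y assume "y \<in> carrier ?Q"
        then obtain b where b: "b \<in> qterms G" "y = ?c b" by (auto simp: carr)
        have "qop ?Q (?c (Inv b t)) (?c t) = y"
          using b t eqI[OF pres_eq.op_inv] by (simp add: qop_presented_quandle)
        moreover have "?c (Inv b t) \<in> carrier ?Q" using b t by (simp add: carr)
        ultimately show "y \<in> (\<lambda>x. qop ?Q x (?c t)) ` carrier ?Q" by blast
      qed
    qed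
  qed
  have idem: "qop ?Q (?c t) (?c t) = ?c t" if "t \<in> qterms G" for t
    using that by (simp add: qop_presented_quandle eqI[OF pres_eq.idem])
  have dist: "qop ?Q (qop ?Q (?c s) (?c t)) (?c u) =
      qop ?Q (qop ?Q (?c s) (?c u)) (qop ?Q (?c t) (?c u))"
    if "s \<in> qterms G" "t \<in> qterms G" "u \<in> qterms G" for s t u
    using eqI[OF pres_eq.distrib[OF that]] that by (simp add: qop_presented_quandle)
  have closed: "qop ?Q (?c s) (?c t) \<in> carrier ?Q" if "s \<in> qterms G" "t \<in> qterms G" for s t
    using that by (simp add: qop_presented_quandle carr)
  show ?thesis
    unfolding is_quandle_def
  proof (intro conjI ballI)
    fix x y assume "x \<in> carrier ?Q" "y \<in> carrier ?Q"
    then show "qop ?Q x y \<in> carrier ?Q" using closed unfolding carr by blast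
  next
    fix x assume "x \<in> carrier ?Q"
    then show "qop ?Q x x = x" using idem unfolding carr by blast
  next
    fix y assume "y \<in> carrier ?Q"
    then show "bij_betw (\<lambda>x. qop ?Q x y) (carrier ?Q) (carrier ?Q)"
      using bij unfolding carr by blast
  next
    fix x y z assume "x \<in> carrier ?Q" "y \<in> carrier ?Q" "z \<in> carrier ?Q"
    then obtain s t u where "s \<in> qterms G" "t \<in> qterms G" "u \<in> qterms G"
      "x = ?c s" "y = ?c t" "z = ?c u"
      unfolding carr by blast
    then show "qop ?Q (qop ?Q x y) z = qop ?Q (qop ?Q x z) (qop ?Q y z)"
      using dist by metis
  qed
qed


section \<open>Oriented link diagrams and the fundamental quandle\<close>

text \<open>Around each crossing, drawn with its two strands along the diagonals, there are
  four ends.  A strand is \<open>Rising\<close> if it joins SW to NE and \<open>Falling\<close> if it joins NW to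
  SE.  A diagram records which of the two strands is on top at each crossing and how the
  ends are joined to each other away from the crossings; \<open>glue\<close> is meant to be a
  fixed-point free involution of the ends.  Components without crossings do not occur.\<close>

datatype corner = NW | NE | SW | SE

datatype slope = Rising | Falling

fun opposite :: "corner \<Rightarrow> corner" where
  "opposite NW = SE" | "opposite SE = NW" | "opposite NE = SW" | "opposite SW = NE"

fun clockwise :: "corner \<Rightarrow> corner" where
  "clockwise NW = NE" | "clockwise NE = SE" | "clockwise SE = SW" | "clockwise SW = NW"

fun slope_of :: "corner \<Rightarrow> slope" where
  "slope_of SW = Rising" | "slope_of NE = Rising" |
  "slope_of NW = Falling" | "slope_of SE = Falling"

fun flip :: "slope \<Rightarrow> slope" where
  "flip Rising = Falling" | "flip Falling = Rising"

record 'c diagram =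
  crossings :: "'c set"
  over :: "'c \<Rightarrow> slope"
  glue :: "'c \<times> corner \<Rightarrow> 'c \<times> corner"

definition ends :: "'c diagram \<Rightarrow> ('c \<times> corner) set" where
  "ends D = crossings D \<times> UNIV"

text \<open>An orientation is given by the set of those ends at which the strand runs towards
  the crossing.\<close>

definition is_orientation :: "'c diagram \<Rightarrow> ('c \<times> corner) set \<Rightarrow> bool" where
  "is_orientation D I \<longleftrightarrow> I \<subseteq> ends D \<and>
     (\<forall>(c, u)\<in>ends D. (c, opposite u) \<in> I \<longleftrightarrow> (c, u) \<notin> I) \<and>
     (\<forall>e\<in>ends D. glue D e \<in> I \<longleftrightarrow> e \<notin> I)"

text \<open>An arc, as the set of ends lying on it, runs along the connections between the
  crossings and through every crossing where it is on top.\<close>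

definition arc_step :: "'c diagram \<Rightarrow> (('c \<times> corner) \<times> ('c \<times> corner)) set" where
  "arc_step D = {(e, glue D e) | e. e \<in> ends D} \<union>
     {((c, u), (c, opposite u)) | c u. c \<in> crossings D \<and> slope_of u = over D c}"

definition arc :: "'c diagram \<Rightarrow> 'c \<times> corner \<Rightarrow> ('c \<times> corner) set" where
  "arc D e = (arc_step D)\<^sup>* `` {e}"

definition arcs :: "'c diagram \<Rightarrow> ('c \<times> corner) set set" where
  "arcs D = arc D ` ends D"

text \<open>If the upper strand enters the crossing at the corner \<open>u\<close>, then the corner
  \<open>clockwise u\<close> is on its left and \<open>opposite (clockwise u)\<close> is on its right.\<close>

definition crossing_relations ::
  "'c diagram \<Rightarrow> ('c \<times> corner) set \<Rightarrow>
    (('c \<times> corner) set qterm \<times> ('c \<times> corner) set qterm) set" where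
  "crossing_relations D I =
     {(Gen (arc D (c, clockwise u)),
       Op (Gen (arc D (c, opposite (clockwise u)))) (Gen (arc D (c, u)))) | c u.
       c \<in> crossings D \<and> slope_of u = over D c \<and> (c, u) \<in> I}"

definition fundamental_quandle ::
  "'c diagram \<Rightarrow> ('c \<times> corner) set \<Rightarrow> ('c \<times> corner) set qterm set quandle" where
  "fundamental_quandle D I = presented_quandle (arcs D) (crossing_relations D I)"


section \<open>Pretzel links\<close>

text \<open>The tangles are numbered \<open>0, \<dots>, m - 1\<close> from left to right, and the crossing
  \<open>(i, k)\<close> is the one number \<open>k\<close>, counted from the top, in tangle \<open>i\<close>.  The parameter
  \<open>s\<close> is the slope of the upper strand in the tangles regarded as positive, so that both
  conventions for the handedness are available.\<close>

fun pretzel_glue :: "nat \<Rightarrow> (nat \<Rightarrow> int) \<Rightarrow> (nat \<times> nat) \<times> corner \<Rightarrow> (nat \<times> nat) \<times> corner" where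
  "pretzel_glue m p ((i, k), NW) =
     (if k = 0 then (((i + m - 1) mod m, 0), NE) else ((i, k - 1), SW))"
| "pretzel_glue m p ((i, k), NE) =
     (if k = 0 then (((i + 1) mod m, 0), NW) else ((i, k - 1), SE))"
| "pretzel_glue m p ((i, k), SW) =
     (if k + 1 < nat \<bar>p i\<bar> then ((i, k + 1), NW)
      else (let j = (i + m - 1) mod m in ((j, nat \<bar>p j\<bar> - 1), SE)))"
| "pretzel_glue m p ((i, k), SE) =
     (if k + 1 < nat \<bar>p i\<bar> then ((i, k + 1), NE)
      else (let j = (i + 1) mod m in ((j, nat \<bar>p j\<bar> - 1), SW)))"

definition pretzel_diagram :: "slope \<Rightarrow> nat \<Rightarrow> (nat \<Rightarrow> int) \<Rightarrow> (nat \<times> nat) diagram" where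
  "pretzel_diagram s m p =
     \<lparr>crossings = {(i, k). i < m \<and> k < nat \<bar>p i\<bar>},
      over = (\<lambda>(i, k). if p i > 0 then s else flip s),
      glue = pretzel_glue m p\<rparr>"

lemma pretzel_glue_involution:
  assumes "\<forall>i<m. p i \<noteq> 0" and "e \<in> ends (pretzel_diagram s m p)"
  shows "pretzel_glue m p e \<in> ends (pretzel_diagram s m p)"
    and "pretzel_glue m p e \<noteq> e"
    and "pretzel_glue m p (pretzel_glue m p e) = e"
proof -
  obtain i k u where e: "e = ((i, k), u)" by (metis surj_pair)
  have i: "i < m" and k: "k < nat \<bar>p i\<bar>"
    using assms(2) by (auto simp: e ends_def pretzel_diagram_def)
  have succ: "((i + 1) mod m + m - 1) mod m = i"
    using i by (cases "i + 1 = m") auto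
  have pred: "((i + m - 1) mod m + 1) mod m = i"
    using i by (cases i) auto
  have lt: "(i + 1) mod m < m" "(i + m - 1) mod m < m"
    using i by auto
  have pos: "nat \<bar>p j\<bar> > 0" if "j < m" for j
    using assms(1) that by auto
  show "pretzel_glue m p e \<in> ends (pretzel_diagram s m p)"
    using i k lt pos[OF lt(1)] pos[OF lt(2)]
    by (cases u) (auto simp: e ends_def pretzel_diagram_def Let_def)
  show "pretzel_glue m p e \<noteq> e"
    by (cases u) (auto simp: e Let_def)
  have bottom: "\<not> Suc k < nat \<bar>p i\<bar> \<Longrightarrow> nat \<bar>p i\<bar> - Suc 0 = k"
    using k by arith
  show "pretzel_glue m p (pretzel_glue m p e) = e"
    using i k bottom succ pred pos[OF lt(1)] pos[OF lt(2)]
    by (cases u) (auto simp: e Let_def)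
qed


section \<open>Directed pseudographs and coloring quivers\<close>

record 'v pseudograph =
  verts :: "'v set"
  weight :: "'v \<Rightarrow> 'v \<Rightarrow> nat"

definition pseudograph_iso :: "'v pseudograph \<Rightarrow> 'w pseudograph \<Rightarrow> bool" where
  "pseudograph_iso G H \<longleftrightarrow> (\<exists>\<pi>. bij_betw \<pi> (verts G) (verts H) \<and>
     (\<forall>x\<in>verts G. \<forall>y\<in>verts G. weight H (\<pi> x) (\<pi> y) = weight G x y))"

definition complete_graph :: "nat \<Rightarrow> nat \<Rightarrow> nat pseudograph" where
  "complete_graph N k = \<lparr>verts = {..<N}, weight = (\<lambda>x y. k)\<rparr>"

text \<open>The additional edges run from the second graph to the first one.\<close>

definition join_left :: "'v pseudograph \<Rightarrow> nat \<Rightarrow> 'w pseudograph \<Rightarrow> ('v + 'w) pseudograph" where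
  "join_left G c H =
     \<lparr>verts = verts G <+> verts H,
      weight = (\<lambda>a b. case (a, b) of
         (Inl x, Inl y) \<Rightarrow> weight G x y
       | (Inl x, Inr y) \<Rightarrow> 0
       | (Inr x, Inl y) \<Rightarrow> c
       | (Inr x, Inr y) \<Rightarrow> weight H x y)\<rparr>"

definition copies :: "nat \<Rightarrow> 'v pseudograph \<Rightarrow> (nat \<times> 'v) pseudograph" where
  "copies k G =
     \<lparr>verts = {..<k} \<times> verts G,
      weight = (\<lambda>(i, x) (j, y). if i = j then weight G x y else 0)\<rparr>"

definition coloring_quiver ::
  "'a quandle \<Rightarrow> 'c diagram \<Rightarrow> ('c \<times> corner) set \<Rightarrow>
    (('c \<times> corner) set qterm set \<Rightarrow> 'a) pseudograph" where
  "coloring_quiver X D I =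
     \<lparr>verts = quandle_hom (fundamental_quandle D I) X,
      weight = (\<lambda>f g. card {\<phi> \<in> quandle_hom X X.
         g = compose (carrier (fundamental_quandle D I)) \<phi> f})\<rparr>"

end

theory Submission
  imports Defs
begin

text \<open>A coloring of a link by \<open>\<int>\<^sub>n\<close> is the same as a Fox coloring of a diagram, and for prime \<open>n\<close>
  these form a vector space over the field with \<open>n\<close> elements.  The first half of the proof
  is that this space determines the quiver through its cardinality alone.  The endomorphisms of
  \<open>\<int>\<^sub>n\<close> are the affine maps: \<open>2 (k + 1) - k = k + 2\<close> turns the homomorphism condition into a
  second-order linear recurrence, which also covers \<open>n = 2\<close>, where the quandle is trivial.
  An affine map over a field is determined by its values at two distinct points, and these
  values can be prescribed (\<open>bij_betw_dihedral_endo_two_points\<close>).  Hence between constant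
  colorings there are always \<open>n\<close> edges, no edge leads from a constant coloring to a
  non-constant one, there is one edge from each non-constant coloring to each constant one, and
  the non-constant colorings fall into orbits of the \<open>n (n - 1)\<close> invertible affine maps, with
  one edge between any two members of an orbit and none between different orbits.  So the
  quiver of a nonempty quandle with finitely many colorings, \<open>N\<close> in number, consists of the \<open>n\<close>
  constant colorings joined with \<open>(N - n) / (n (n - 1))\<close> complete graphs (\<open>dihedral_quiver_iso\<close>).

  The second half counts the colorings of the pretzel link.  A crossing whose upper ends have
  the colors \<open>a\<close>, \<open>b\<close> translates this pair by \<open>b - a\<close> or by \<open>a - b\<close>, according to its
  handedness, so both columns of a tangle are arithmetic progressions.  If \<open>x\<^sub>i\<close> is the color at
  the top left of the tangle \<open>i\<close> and \<open>d\<^sub>i = x\<^sub>i\<^sub>+\<^sub>1 - x\<^sub>i\<close>, with cyclic indices, the only condition that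
  remains comes from the connections at the bottom: all the products \<open>p\<^sub>i d\<^sub>i\<close> have one common
  value \<open>c\<close> (\<open>bij_betw_pretzel_solutions\<close>).  Let \<open>k\<close> be the number of \<open>p\<^sub>i\<close> divisible by \<open>n\<close>.

  If \<open>k > 0\<close>, then \<open>c = 0\<close>, so \<open>d\<^sub>i = 0\<close> at all other tangles, the colors \<open>x\<^sub>i\<close> at the \<open>k\<close> divisible
  ones are free, and \<open>N = n\<^sup>k\<close> (\<open>card_pretzel_solutions_vanishing\<close>).  If \<open>k = 0\<close>, then \<open>d\<^sub>i = c / p\<^sub>i\<close>,
  and going once around requires \<open>c \<Sum>1/p\<^sub>i = 0\<close>.  Since \<open>h\<close> is the product of all \<open>p\<^sub>i\<close> times
  \<open>\<Sum>1/p\<^sub>i\<close>, this leaves \<open>N = n\<close> or \<open>N = n\<^sup>2\<close> depending on \<open>h\<close> (\<open>card_pretzel_solutions_units\<close>).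
  For \<open>k > 0\<close> the number \<open>h\<close> is nonzero modulo \<open>n\<close> precisely if \<open>k = 1\<close>
  (\<open>sum_prod_omit_one_cong_0_iff\<close>), and each of the cases of the theorem fixes \<open>N\<close>.\<close>

section \<open>Homomorphisms out of a presented quandle\<close>

primrec qeval :: "'a quandle \<Rightarrow> ('g \<Rightarrow> 'a) \<Rightarrow> 'g qterm \<Rightarrow> 'a" where
  "qeval X c (Gen g) = c g"
| "qeval X c (Op s t) = qop X (qeval X c s) (qeval X c t)"
| "qeval X c (Inv s t) =
     the_inv_into (carrier X) (\<lambda>x. qop X x (qeval X c t)) (qeval X c s)"

lemma is_quandleD:
  assumes "is_quandle X"
  shows "\<And>x y. x \<in> carrier X \<Longrightarrow> y \<in> carrier X \<Longrightarrow> qop X x y \<in> carrier X"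
    and "\<And>x. x \<in> carrier X \<Longrightarrow> qop X x x = x"
    and "\<And>y. y \<in> carrier X \<Longrightarrow> bij_betw (\<lambda>x. qop X x y) (carrier X) (carrier X)"
    and "\<And>x y z. x \<in> carrier X \<Longrightarrow> y \<in> carrier X \<Longrightarrow> z \<in> carrier X \<Longrightarrow>
      qop X (qop X x y) z = qop X (qop X x z) (qop X y z)"
  using assms unfolding is_quandle_def by blast+

lemma quandle_homD:
  assumes "f \<in> quandle_hom X Y"
  shows "\<And>x y. x \<in> carrier X \<Longrightarrow> y \<in> carrier X \<Longrightarrow> f (qop X x y) = qop Y (f x) (f y)"
    and "\<And>x. x \<in> carrier X \<Longrightarrow> f x \<in> carrier Y"
  using assms by (auto simp: quandle_hom_def)

lemma right_translation_inverse:
  assumes "is_quandle X" "x \<in> carrier X" "y \<in> carrier X"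
  shows "the_inv_into (carrier X) (\<lambda>x. qop X x y) x \<in> carrier X"
    and "qop X (the_inv_into (carrier X) (\<lambda>x. qop X x y) x) y = x"
    and "the_inv_into (carrier X) (\<lambda>x. qop X x y) (qop X x y) = x"
proof -
  note b = is_quandleD(3)[OF assms(1,3)]
  then have inj: "inj_on (\<lambda>x. qop X x y) (carrier X)"
    and im: "(\<lambda>x. qop X x y) ` carrier X = carrier X"
    by (auto simp: bij_betw_def)
  show "the_inv_into (carrier X) (\<lambda>x. qop X x y) x \<in> carrier X"
    using the_inv_into_into[OF inj] im assms(2) by blast
  show "qop X (the_inv_into (carrier X) (\<lambda>x. qop X x y) x) y = x"
    using f_the_inv_into_f_bij_betw[OF b] assms(2) by blast
  show "the_inv_into (carrier X) (\<lambda>x. qop X x y) (qop X x y) = x"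
    using the_inv_into_f_f[OF inj assms(2)] .
qed

lemma qeval_closed:
  assumes "is_quandle X" "c \<in> G \<rightarrow> carrier X" "t \<in> qterms G"
  shows "qeval X c t \<in> carrier X"
  using assms(3)
  by (induction t)
    (use assms(1,2) in \<open>auto intro: is_quandleD(1) right_translation_inverse(1)\<close>)

text \<open>Each rule that generates \<open>pres_eq\<close> is either a relator or a law that holds in every quandle.\<close>

lemma qeval_pres_eq:
  assumes X: "is_quandle X" and c: "c \<in> G \<rightarrow> carrier X"
    and R: "\<And>s t. (s, t) \<in> R \<Longrightarrow> s \<in> qterms G \<Longrightarrow> t \<in> qterms G \<Longrightarrow> qeval X c s = qeval X c t"
    and st: "(s, t) \<in> pres_eq G R"
  shows "qeval X c s = qeval X c t"
  using st
proof (induction rule: pres_eq.induct)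
  (* self-distributivity would loop as a rewrite rule *)
  case (distrib s t u)
  then show ?case
    by (simp only: qeval.simps) (intro is_quandleD(4)[OF X] qeval_closed[OF X c])
qed (simp_all add: R qeval_closed[OF X c] is_quandleD(2)[OF X] right_translation_inverse[OF X])

text \<open>A homomorphism is only required to respect \<open>Op\<close>.  It respects \<open>Inv\<close> as well: the relation
  \<open>Op (Inv s t) t = s\<close> holds in the presented quandle, and right translations of the target are
  injective.\<close>

lemma quandle_hom_qeval:
  assumes X: "is_quandle X" and f: "f \<in> quandle_hom (presented_quandle G R) X"
    and t: "t \<in> qterms G"
  shows "f (pres_eq G R `` {t}) = qeval X (\<lambda>g. f (pres_eq G R `` {Gen g})) t"
  using t
proof (induction t)
  case (Gen g)
  then show ?case by simp
next
  case (Op s t)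
  then have "pres_eq G R `` {s} \<in> carrier (presented_quandle G R)"
    "pres_eq G R `` {t} \<in> carrier (presented_quandle G R)"
    by (auto simp: presented_quandle_def quotient_def)
  from quandle_homD(1)[OF f this] Op show ?case
    by (simp add: qop_presented_quandle)
next
  case (Inv s t)
  let ?E = "pres_eq G R"
  have st: "s \<in> qterms G" "t \<in> qterms G" using Inv.prems by simp_all
  then have carr: "?E `` {Inv s t} \<in> carrier (presented_quandle G R)"
    "?E `` {t} \<in> carrier (presented_quandle G R)"
    by (auto simp: presented_quandle_def quotient_def)
  have "?E `` {Op (Inv s t) t} = ?E `` {s}"
    by (rule equiv_class_eq[OF equiv_pres_eq pres_eq.op_inv[OF st]])
  with quandle_homD(1)[OF f carr] st
  have "qop X (f (?E `` {Inv s t})) (f (?E `` {t})) = f (?E `` {s})"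
    by (simp add: qop_presented_quandle)
  then have "f (?E `` {Inv s t}) =
      the_inv_into (carrier X) (\<lambda>x. qop X x (f (?E `` {t}))) (f (?E `` {s}))"
    using right_translation_inverse(3)[OF X] quandle_homD(2)[OF f] carr by metis
  then show ?case using Inv.IH st by simp
qed

text \<open>The universal property of a presentation.  The inverse map evaluates any representative of a
  class, which is well defined by \<open>qeval_pres_eq\<close>.\<close>

lemma bij_betw_quandle_hom_presented:
  fixes X :: "'a quandle" and G :: "'g set"
  assumes X: "is_quandle X" and R: "R \<subseteq> qterms G \<times> qterms G"
  shows "bij_betw (\<lambda>f. \<lambda>g\<in>G. f (pres_eq G R `` {Gen g}))
    (quandle_hom (presented_quandle G R) X)
    {c \<in> G \<rightarrow>\<^sub>E carrier X. \<forall>(s, t)\<in>R. qeval X c s = qeval X c t}"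
    (is "bij_betw ?F ?H ?C")
proof (rule bij_betw_imageI)
  let ?E = "pres_eq G R" and ?Q = "presented_quandle G R"
  have carr: "carrier ?Q = (\<lambda>t. ?E `` {t}) ` qterms G"
    by (auto simp: presented_quandle_def quotient_def)
  have qeval_cong: "qeval X c t = qeval X c' t" if "t \<in> qterms G" "\<And>g. g \<in> G \<Longrightarrow> c g = c' g"
    for c c' :: "'g \<Rightarrow> 'a" and t
    using that by (induction t) auto
  have eval: "f (?E `` {t}) = qeval X (?F f) t" if "f \<in> ?H" "t \<in> qterms G" for f t
    unfolding quandle_hom_qeval[OF X that] by (rule qeval_cong[OF that(2)]) simp
  show "inj_on ?F ?H"
  proof (rule inj_onI)
    fix f f' assume f: "f \<in> ?H" "f' \<in> ?H" and eq: "?F f = ?F f'"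
    have "f A = f' A" if "A \<in> carrier ?Q" for A
      using that eval[OF f(1)] eval[OF f(2)] eq unfolding carr by auto
    then show "f = f'"
      using f unfolding quandle_hom_def by (blast intro: PiE_ext)
  qed
  show "?F ` ?H = ?C"
  proof (intro equalityI subsetI)
    fix c assume "c \<in> ?F ` ?H"
    then obtain f where f: "f \<in> ?H" "c = ?F f" by blast
    have "c \<in> G \<rightarrow>\<^sub>E carrier X"
      using quandle_homD(2)[OF f(1)] by (auto simp: f(2) carr)
    moreover have "qeval X c s = qeval X c t" if "(s, t) \<in> R" for s t
    proof -
      have st: "s \<in> qterms G" "t \<in> qterms G" using R that by auto
      then have "?E `` {s} = ?E `` {t}"
        by (intro equiv_class_eq[OF equiv_pres_eq] pres_eq.relator that)
      then show ?thesis using eval[OF f(1)] st by (simp only: f(2)) metis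
    qed
    ultimately show "c \<in> ?C" by auto
  next
    fix c assume c: "c \<in> ?C"
    then have cG: "c \<in> G \<rightarrow> carrier X" by auto
    define f where "f = (\<lambda>A\<in>carrier ?Q. qeval X c (SOME t. t \<in> A))"
    have f: "f (?E `` {t}) = qeval X c t" if "t \<in> qterms G" for t
    proof -
      have "t \<in> ?E `` {t}" using that by (simp add: pres_eq.refl)
      then have "(SOME u. u \<in> ?E `` {t}) \<in> ?E `` {t}" by (rule someI)
      then have "(t, SOME u. u \<in> ?E `` {t}) \<in> ?E" by blast
      then have "qeval X c t = qeval X c (SOME u. u \<in> ?E `` {t})"
        using qeval_pres_eq[OF X cG] c by blast
      then show ?thesis using that by (simp add: f_def carr)
    qed
    have "f \<in> ?H"
      unfolding quandle_hom_def
    proof (intro CollectI conjI ballI PiE_I)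
      fix A assume "A \<in> carrier ?Q"
      then show "f A \<in> carrier X" using f qeval_closed[OF X cG] by (auto simp: carr)
    next
      fix A assume "A \<notin> carrier ?Q"
      then show "f A = undefined" by (simp add: f_def)
    next
      fix A B assume "A \<in> carrier ?Q" "B \<in> carrier ?Q"
      then show "f (qop ?Q A B) = qop X (f A) (f B)"
        unfolding carr by (auto simp: qop_presented_quandle f)
    qed
    moreover have "?F f = c"
      using c f by (auto intro!: ext simp: PiE_def extensional_def)
    ultimately show "c \<in> ?F ` ?H" by blast
  qed
qed


section \<open>Fox colorings of a diagram\<close>

lemma carrier_dihedral [simp]: "carrier (dihedral_quandle n) = {0..<int n}"
  and qop_dihedral [simp]: "qop (dihedral_quandle n) x y = (2 * y - x) mod int n"
  by (simp_all add: dihedral_quandle_def)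

text \<open>The colors sit on the ends at the crossings instead of the arcs, which avoids determining
  which ends lie on a common arc.  No orientation occurs: since \<open>x \<mapsto> 2 y - x\<close> is an involution,
  the crossing relation is symmetric in the two sides of the upper strand.\<close>

definition fox_colorings :: "nat \<Rightarrow> 'c diagram \<Rightarrow> ('c \<times> corner \<Rightarrow> int) set" where
  "fox_colorings n D = {\<gamma> \<in> ends D \<rightarrow>\<^sub>E {0..<int n}.
     (\<forall>e\<in>ends D. \<gamma> (glue D e) = \<gamma> e) \<and>
     (\<forall>c\<in>crossings D. \<forall>u. slope_of u = over D c \<longrightarrow> \<gamma> (c, opposite u) = \<gamma> (c, u) \<and>
        [\<gamma> (c, clockwise u) + \<gamma> (c, opposite (clockwise u)) = 2 * \<gamma> (c, u)] (mod int n))}"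

lemma corner_simps [simp]:
  "opposite (opposite u) = u" "slope_of (opposite u) = slope_of u"
  "clockwise (opposite u) = opposite (clockwise u)"
  by (cases u; simp)+

lemma sym_arc_step:
  assumes "\<forall>e\<in>ends D. glue D e \<in> ends D \<and> glue D (glue D e) = e"
  shows "sym (arc_step D)"
proof (rule symI)
  fix a b assume "(a, b) \<in> arc_step D"
  then consider "a \<in> ends D" "b = glue D a"
    | c u where "a = (c, u)" "b = (c, opposite u)" "c \<in> crossings D" "slope_of u = over D c"
    by (auto simp: arc_step_def)
  then show "(b, a) \<in> arc_step D"
  proof cases
    case 1
    then have "b \<in> ends D" "a = glue D b" using assms by simp_all
    then show ?thesis unfolding arc_step_def by blast
  next
    case 2
    then have "a = (c, opposite (opposite u))" "slope_of (opposite u) = over D c" by simp_all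
    with 2 show ?thesis unfolding arc_step_def by blast
  qed
qed

text \<open>An arc is the set of ends reachable from one of its ends.  Because gluing is an involution,
  the steps can be reversed, so this set does not depend on the chosen end.\<close>

lemma arc_eq_step:
  assumes "\<forall>e\<in>ends D. glue D e \<in> ends D \<and> glue D (glue D e) = e"
    and "(a, b) \<in> arc_step D"
  shows "arc D a = arc D b"
proof -
  have "(b, a) \<in> arc_step D" using sym_arc_step[OF assms(1)] assms(2) by (auto dest: symD)
  with assms(2) show ?thesis
    unfolding arc_def by (blast intro: converse_rtrancl_into_rtrancl)
qed

text \<open>A function on the arcs corresponds to a function on the ends that is invariant under
  \<open>arc_step\<close>; the two conditions on \<open>\<gamma>\<close> besides the crossing relation express this invariance.\<close>

lemma bij_betw_fox_colorings:
  assumes glue: "\<forall>e\<in>ends D. glue D e \<in> ends D \<and> glue D (glue D e) = e"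
    and I: "is_orientation D I"
  shows "bij_betw (\<lambda>c. \<lambda>e\<in>ends D. c (arc D e))
    {c \<in> arcs D \<rightarrow>\<^sub>E {0..<int n}. \<forall>(s, t)\<in>crossing_relations D I.
      qeval (dihedral_quandle n) c s = qeval (dihedral_quandle n) c t} (fox_colorings n D)"
    (is "bij_betw ?F ?C _")
proof (rule bij_betw_imageI)
  note step = arc_eq_step[OF glue]
  have relD: "c (arc D (x, clockwise u)) =
      (2 * c (arc D (x, u)) - c (arc D (x, opposite (clockwise u)))) mod int n"
    if "c \<in> ?C" "x \<in> crossings D" "slope_of u = over D x" "(x, u) \<in> I" for c x u
    using that by (fastforce simp: crossing_relations_def)
  show "inj_on ?F ?C"
  proof (rule inj_onI)
    fix c c' assume c: "c \<in> ?C" "c' \<in> ?C" and eq: "?F c = ?F c'"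
    have "c (arc D e) = c' (arc D e)" if "e \<in> ends D" for e
      using fun_cong[OF eq, of e] that by simp
    then have "\<forall>A\<in>arcs D. c A = c' A" by (auto simp: arcs_def)
    then show "c = c'" using c by (blast intro: PiE_ext)
  qed
  show "?F ` ?C = fox_colorings n D"
  proof (intro equalityI subsetI)
    fix \<gamma> assume "\<gamma> \<in> ?F ` ?C"
    then obtain c where c: "c \<in> ?C" and \<gamma>: "\<gamma> = ?F c" by blast
    have 1: "\<gamma> \<in> ends D \<rightarrow>\<^sub>E {0..<int n}"
    proof
      fix e assume "e \<in> ends D"
      then show "\<gamma> e \<in> {0..<int n}" using c \<gamma> by (auto simp: arcs_def)
    qed (auto simp: \<gamma>)
    have 2: "\<gamma> (glue D e) = \<gamma> e" if "e \<in> ends D" for e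
    proof -
      have "(e, glue D e) \<in> arc_step D" using that unfolding arc_step_def by blast
      from step[OF this] show ?thesis using that glue by (simp add: \<gamma>)
    qed
    have 3: "\<gamma> (x, opposite u) = \<gamma> (x, u)" if "x \<in> crossings D" "slope_of u = over D x" for x u
    proof -
      have "arc D (x, u) = arc D (x, opposite u)"
        using that by (intro step) (auto simp: arc_step_def)
      then show ?thesis using that by (simp add: \<gamma> ends_def)
    qed
    have 4: "[\<gamma> (x, clockwise u) + \<gamma> (x, opposite (clockwise u)) = 2 * \<gamma> (x, u)] (mod int n)"
      if x: "x \<in> crossings D" and u: "slope_of u = over D x" for x u
    proof -
      have in': "[\<gamma> (x, clockwise v) + \<gamma> (x, opposite (clockwise v)) = 2 * \<gamma> (x, v)] (mod int n)"
        if "slope_of v = over D x" "(x, v) \<in> I" for v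
        using relD[OF c x that] x by (simp add: \<gamma> ends_def cong_def mod_add_left_eq)
      \<comment> \<open>The presentation has one relation per crossing, at the end where the upper strand
      enters; the relation at the other end of this strand is the same one.\<close>
      have "(x, u) \<in> I \<or> (x, opposite u) \<in> I"
        using I x by (auto simp: is_orientation_def ends_def)
      then show ?thesis
      proof
        assume "(x, opposite u) \<in> I"
        with in'[of "opposite u"] u show ?thesis by (simp add: 3[OF x u] add.commute)
      qed (use in'[OF u] in simp)
    qed
    show "\<gamma> \<in> fox_colorings n D" unfolding fox_colorings_def using 1 2 3 4 by auto
  next
    fix \<gamma> assume fox: "\<gamma> \<in> fox_colorings n D"
    have step_const: "\<gamma> b = \<gamma> a \<and> b \<in> ends D" if "(a, b) \<in> arc_step D" for a b
      using that unfolding arc_step_def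
    proof (elim UnE CollectE exE conjE)
      fix e assume "(a, b) = (e, glue D e)" "e \<in> ends D"
      then show ?thesis using fox glue by (simp add: fox_colorings_def)
    next
      fix c u assume "(a, b) = ((c, u), (c, opposite u))" "c \<in> crossings D" "slope_of u = over D c"
      then show ?thesis using fox by (simp add: fox_colorings_def ends_def)
    qed
    have const: "\<gamma> b = \<gamma> a" if "b \<in> arc D a" "a \<in> ends D" for a b
    proof -
      have "(a, b) \<in> (arc_step D)\<^sup>*" using that(1) by (simp add: arc_def)
      then have "\<gamma> b = \<gamma> a \<and> b \<in> ends D"
        by (induction rule: rtrancl_induct) (use that(2) step_const in auto)
      then show ?thesis ..
    qed
    define c where "c = (\<lambda>A\<in>arcs D. \<gamma> (SOME e. e \<in> A))"
    have c: "c (arc D e) = \<gamma> e" if "e \<in> ends D" for e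
    proof -
      have "e \<in> arc D e" by (simp add: arc_def)
      then have "(SOME e'. e' \<in> arc D e) \<in> arc D e" by (rule someI)
      from const[OF this that] that show ?thesis by (simp add: c_def arcs_def)
    qed
    have "c \<in> arcs D \<rightarrow>\<^sub>E {0..<int n}"
    proof
      fix A assume "A \<in> arcs D"
      then show "c A \<in> {0..<int n}" using c fox by (auto simp: arcs_def fox_colorings_def)
    qed (simp add: c_def)
    moreover have "\<gamma> (x, clockwise u) = (2 * \<gamma> (x, u) - \<gamma> (x, opposite (clockwise u))) mod int n"
      if "x \<in> crossings D" "slope_of u = over D x" for x u
    proof -
      have "[\<gamma> (x, clockwise u) + \<gamma> (x, opposite (clockwise u)) = 2 * \<gamma> (x, u)] (mod int n)"
        "\<gamma> (x, clockwise u) \<in> {0..<int n}"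
        using fox that by (auto simp: fox_colorings_def ends_def)
      then show ?thesis
        by (metis add_diff_cancel_right' atLeastLessThan_iff cong_def mod_diff_left_eq mod_pos_pos_trivial)
    qed
    then have "qeval (dihedral_quandle n) c s = qeval (dihedral_quandle n) c t"
      if "(s, t) \<in> crossing_relations D I" for s t
      using that by (auto simp: crossing_relations_def c ends_def)
    ultimately have "c \<in> ?C" by auto
    moreover have "?F c = \<gamma>"
      using fox c by (auto simp: fox_colorings_def PiE_def extensional_def)
    ultimately show "\<gamma> \<in> ?F ` ?C" by blast
  qed
qed

lemma card_hom_eq_card_fox_colorings:
  assumes glue: "\<forall>e\<in>ends D. glue D e \<in> ends D \<and> glue D (glue D e) = e"
    and I: "is_orientation D I"
  shows "card (quandle_hom (fundamental_quandle D I) (dihedral_quandle n)) =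
    card (fox_colorings n D)"
proof -
  have "crossing_relations D I \<subseteq> qterms (arcs D) \<times> qterms (arcs D)"
    by (auto simp: crossing_relations_def arcs_def ends_def)
  from bij_betw_same_card[OF bij_betw_quandle_hom_presented[OF is_quandle_dihedral this]]
    bij_betw_same_card[OF bij_betw_fox_colorings[OF glue I]]
  show ?thesis by (simp add: fundamental_quandle_def)
qed


section \<open>Endomorphisms of a dihedral quandle of prime order\<close>

lemma cong_residues_eq:
  fixes a b :: int
  assumes "[a = b] (mod int n)" "a \<in> {0..<int n}" "b \<in> {0..<int n}"
  shows "a = b"
  using assms by (simp add: cong_def)

lemma prime_cong_mult_cancel:
  fixes a x y :: int
  assumes "prime n" "\<not> int n dvd a" "[a * x = a * y] (mod int n)"
  shows "[x = y] (mod int n)"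
proof -
  have "coprime a (int n)"
    using assms(1,2) prime_imp_coprime[of "int n" a] by (simp add: coprime_commute)
  with assms(3) show ?thesis using cong_mult_lcancel by blast
qed

abbreviation dihedral_endos :: "nat \<Rightarrow> (int \<Rightarrow> int) set" where
  "dihedral_endos n \<equiv> quandle_hom (dihedral_quandle n) (dihedral_quandle n)"

text \<open>For consecutive \<open>k\<close>, \<open>k + 1\<close>, \<open>k + 2\<close> the homomorphism condition reads
  \<open>\<phi> (k + 2) = 2 \<phi> (k + 1) - \<phi> k\<close>, so the values form an arithmetic progression.\<close>

lemma dihedral_endo_affine:
  assumes "\<phi> \<in> dihedral_endos n" "x \<in> {0..<int n}"
  shows "[\<phi> x = \<phi> 0 + x * (\<phi> 1 - \<phi> 0)] (mod int n)"
proof -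
  have "[\<phi> (int k) = \<phi> 0 + int k * (\<phi> 1 - \<phi> 0)] (mod int n)" if "k < n" for k
    using that
  proof (induction k rule: induct_nat_012)
    case (ge2 k)
    have "\<phi> ((2 * int (Suc k) - int k) mod int n) =
        (2 * \<phi> (int (Suc k)) - \<phi> (int k)) mod int n"
      using quandle_homD(1)[OF assms(1), of "int k" "int (Suc k)"] ge2.prems by simp
    moreover have "(2 * int (Suc k) - int k) mod int n = int (Suc (Suc k))"
      using ge2.prems by simp
    ultimately have "[\<phi> (int (Suc (Suc k))) = 2 * \<phi> (int (Suc k)) - \<phi> (int k)] (mod int n)"
      by (simp only: cong_mod_left cong_refl)
    also have "[2 * \<phi> (int (Suc k)) - \<phi> (int k) =
        2 * (\<phi> 0 + int (Suc k) * (\<phi> 1 - \<phi> 0)) - (\<phi> 0 + int k * (\<phi> 1 - \<phi> 0))] (mod int n)"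
      using ge2 by (intro cong_diff cong_mult cong_refl) simp_all
    finally show ?case by (simp add: algebra_simps)
  qed simp_all
  from this[of "nat x"] assms(2) show ?thesis by (simp add: nat_less_iff)
qed

lemma affine_dihedral_endo:
  assumes "n > 0"
  shows "(\<lambda>x\<in>{0..<int n}. (a * x + b) mod int n) \<in> dihedral_endos n"
proof -
  have "(a * ((2 * y - x) mod int n) + b) mod int n =
      (2 * ((a * y + b) mod int n) - (a * x + b) mod int n) mod int n" for x y
  proof -
    have "[a * ((2 * y - x) mod int n) + b = a * (2 * y - x) + b] (mod int n)"
      by (intro cong_add cong_mult cong_refl) simp
    moreover have "[2 * ((a * y + b) mod int n) - (a * x + b) mod int n =
        2 * (a * y + b) - (a * x + b)] (mod int n)"
      by (intro cong_diff cong_mult cong_refl) simp_all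
    moreover have "a * (2 * y - x) + b = 2 * (a * y + b) - (a * x + b)"
      by (simp add: algebra_simps)
    ultimately show ?thesis by (simp add: cong_def)
  qed
  then show ?thesis using assms by (auto simp: quandle_hom_def)
qed

text \<open>Over a field there is exactly one affine map with prescribed values at two distinct points.
  All the numbers of edges in the quiver are derived from this fact.\<close>

lemma bij_betw_dihedral_endo_two_points:
  assumes n: "prime n" and u: "u \<in> {0..<int n}" and v: "v \<in> {0..<int n}" and uv: "u \<noteq> v"
  shows "bij_betw (\<lambda>\<phi>. (\<phi> u, \<phi> v)) (dihedral_endos n) ({0..<int n} \<times> {0..<int n})"
proof (rule bij_betw_imageI)
  have n0: "n > 0" using n prime_gt_0_nat by blast
  have ndvd: "\<not> int n dvd v - u"
  proof
    assume "int n dvd v - u"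
    then have "[v = u] (mod int n)" by (simp add: cong_iff_dvd_diff)
    with u v uv show False using cong_residues_eq by blast
  qed
  have range: "\<phi> x \<in> {0..<int n}" if "\<phi> \<in> dihedral_endos n" "x \<in> {0..<int n}" for \<phi> x
    using quandle_homD(2)[OF that(1)] that(2) by simp
  show "inj_on (\<lambda>\<phi>. (\<phi> u, \<phi> v)) (dihedral_endos n)"
  proof (rule inj_onI)
    fix \<phi> \<psi> assume \<phi>: "\<phi> \<in> dihedral_endos n" and \<psi>: "\<psi> \<in> dihedral_endos n"
      and "(\<phi> u, \<phi> v) = (\<psi> u, \<psi> v)"
    then have eq: "\<phi> u = \<psi> u" "\<phi> v = \<psi> v" by simp_all
    define a where "a = \<phi> 1 - \<phi> 0"
    define a' where "a' = \<psi> 1 - \<psi> 0"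
    note \<phi>_aff = dihedral_endo_affine[OF \<phi>, folded a_def]
    note \<psi>_aff = dihedral_endo_affine[OF \<psi>, folded a'_def]
    have "[(\<phi> 0 + v * a) - (\<phi> 0 + u * a) = (\<psi> 0 + v * a') - (\<psi> 0 + u * a')] (mod int n)"
      using \<phi>_aff[OF u] \<phi>_aff[OF v] \<psi>_aff[OF u] \<psi>_aff[OF v] eq
      by (intro cong_diff) (metis cong_sym cong_trans)+
    then have "[(v - u) * a = (v - u) * a'] (mod int n)" by (simp add: algebra_simps)
    then have aa: "[a = a'] (mod int n)" by (rule prime_cong_mult_cancel[OF n ndvd])
    have "[(\<phi> 0 + u * a) - u * a = (\<psi> 0 + u * a') - u * a'] (mod int n)"
      using \<phi>_aff[OF u] \<psi>_aff[OF u] eq(1)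
      by (intro cong_diff cong_mult cong_refl aa) (metis cong_sym cong_trans)
    then have "[\<phi> 0 = \<psi> 0] (mod int n)" by simp
    then have "[\<phi> 0 + x * a = \<psi> 0 + x * a'] (mod int n)" for x
      by (intro cong_add cong_mult cong_refl aa)
    then have "[\<phi> x = \<psi> x] (mod int n)" if "x \<in> {0..<int n}" for x
      using \<phi>_aff[OF that] \<psi>_aff[OF that] by (metis cong_sym cong_trans)
    then have "\<phi> x = \<psi> x" if "x \<in> {0..<int n}" for x
      using that range[OF \<phi>] range[OF \<psi>] by (blast intro: cong_residues_eq)
    moreover have "\<phi> \<in> {0..<int n} \<rightarrow>\<^sub>E {0..<int n}" "\<psi> \<in> {0..<int n} \<rightarrow>\<^sub>E {0..<int n}"
      using \<phi> \<psi> by (simp_all add: quandle_hom_def)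
    ultimately show "\<phi> = \<psi>" by (blast intro: PiE_ext)
  qed
  show "(\<lambda>\<phi>. (\<phi> u, \<phi> v)) ` dihedral_endos n = {0..<int n} \<times> {0..<int n}"
  proof (intro equalityI subsetI)
    fix w assume "w \<in> {0..<int n} \<times> {0..<int n}"
    then obtain s t where w: "w = (s, t)" and st: "s \<in> {0..<int n}" "t \<in> {0..<int n}" by blast
    have "coprime (v - u) (int n)"
      using ndvd n prime_imp_coprime[of "int n" "v - u"] by (simp add: coprime_commute)
    then obtain q where q: "[(v - u) * q = 1] (mod int n)" using cong_solve_coprime_int by blast
    \<comment> \<open>The slope of the line through \<open>(u, s)\<close> and \<open>(v, t)\<close>.\<close>
    define a where "a = (t - s) * q"
    let ?\<phi> = "\<lambda>x\<in>{0..<int n}. (a * x + (s - a * u)) mod int n"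
    have "[s + (t - s) * ((v - u) * q) = s + (t - s) * 1] (mod int n)"
      by (intro cong_add cong_mult cong_refl q)
    then have "(s + (t - s) * ((v - u) * q)) mod int n = t"
      using st(2) by (simp add: cong_def)
    moreover have "s + (t - s) * ((v - u) * q) = a * v + (s - a * u)"
      by (simp add: a_def algebra_simps)
    ultimately have "w = (?\<phi> u, ?\<phi> v)" using u v st w by simp
    then show "w \<in> (\<lambda>\<phi>. (\<phi> u, \<phi> v)) ` dihedral_endos n"
      using affine_dihedral_endo[OF n0] by (rule image_eqI)
  qed (use u v range in auto)
qed


section \<open>The coloring quiver in terms of the number of colorings\<close>

lemma card_preimage_bij_betw:
  assumes "bij_betw F A B" "B' \<subseteq> B"
  shows "card {a \<in> A. F a \<in> B'} = card B'"
proof -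
  have "bij_betw F {a \<in> A. F a \<in> B'} B'"
    using assms by (auto simp: bij_betw_def inj_on_def)
  then show ?thesis by (rule bij_betw_same_card)
qed

text \<open>If all classes have the same size \<open>k\<close>, then numbering the classes, and the elements within
  each class, identifies the set with a rectangle whose rows are the classes.  This is the vertex
  set of a disjoint union of copies of one graph.\<close>

lemma equiv_class_coordinates:
  assumes fin: "finite N" and r: "equiv N r" and k: "k > 0"
    and classes: "\<And>x. x \<in> N \<Longrightarrow> card (r `` {x}) = k"
  obtains \<beta> where "bij_betw \<beta> N ({..<card N div k} \<times> {..<k})"
    and "\<And>x y. x \<in> N \<Longrightarrow> y \<in> N \<Longrightarrow> fst (\<beta> x) = fst (\<beta> y) \<longleftrightarrow> (x, y) \<in> r"
proof -
  have fin_r: "finite (r `` {x})" for x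
    using fin r finite_subset[of "r `` {x}" N] by (auto simp: equiv_def)
  have "k * card (N // r) = card (\<Union>(N // r))"
  proof (rule card_partition)
    show "finite (N // r)" using fin r by (simp add: equiv_type finite_quotient)
    show "finite (\<Union>(N // r))" using fin r by (simp add: Union_quotient)
    show "card c = k" if "c \<in> N // r" for c using that classes by (auto simp: quotient_def)
    show "c1 \<inter> c2 = {}" if "c1 \<in> N // r" "c2 \<in> N // r" "c1 \<noteq> c2" for c1 c2
      using that quotient_disj[OF r] by blast
  qed
  then have cardN: "k * card (N // r) = card N" using r by (simp add: Union_quotient)
  have "finite (N // r)" using fin r by (simp add: equiv_type finite_quotient)
  then obtain \<kappa> where \<kappa>: "bij_betw \<kappa> (N // r) {..<card (N // r)}"
    using ex_bij_betw_finite_nat by (metis atLeast0LessThan)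
  have "\<forall>A\<in>N // r. \<exists>\<tau>. bij_betw \<tau> A {..<k}"
  proof
    fix A assume "A \<in> N // r"
    then have "finite A" "card A = k" using classes fin_r by (auto simp: quotient_def)
    then show "\<exists>\<tau>. bij_betw \<tau> A {..<k}" using ex_bij_betw_finite_nat by (metis atLeast0LessThan)
  qed
  then obtain \<tau> where \<tau>: "\<And>A. A \<in> N // r \<Longrightarrow> bij_betw (\<tau> A) A {..<k}" by metis
  define \<beta> where "\<beta> x = (\<kappa> (r `` {x}), \<tau> (r `` {x}) x)" for x
  have cls: "r `` {x} \<in> N // r" if "x \<in> N" for x using that by (rule quotientI)
  have self: "x \<in> r `` {x}" if "x \<in> N" for x using r that by (rule equiv_class_self)
  have fst_iff: "fst (\<beta> x) = fst (\<beta> y) \<longleftrightarrow> (x, y) \<in> r" if "x \<in> N" "y \<in> N" for x y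
  proof -
    have "\<kappa> (r `` {x}) = \<kappa> (r `` {y}) \<longleftrightarrow> r `` {x} = r `` {y}"
      using \<kappa> cls that by (auto simp: bij_betw_def inj_on_def)
    then show ?thesis using eq_equiv_class_iff[OF r that] by (simp add: \<beta>_def)
  qed
  have "inj_on \<beta> N"
  proof (rule inj_onI)
    fix x y assume xy: "x \<in> N" "y \<in> N" and eq: "\<beta> x = \<beta> y"
    then have same: "r `` {x} = r `` {y}"
      using fst_iff[OF xy] by (intro equiv_class_eq[OF r]) simp
    then have "\<tau> (r `` {x}) x = \<tau> (r `` {x}) y" using eq by (simp add: \<beta>_def)
    then show "x = y"
      using \<tau>[OF cls[OF xy(1)]] self[OF xy(1)] self[OF xy(2)] same
      by (auto simp: bij_betw_def dest: inj_onD)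
  qed
  moreover have "\<beta> ` N \<subseteq> {..<card (N // r)} \<times> {..<k}"
    using \<kappa> \<tau> cls self by (fastforce simp: \<beta>_def bij_betw_def)
  moreover have "card ({..<card (N // r)} \<times> {..<k}) = card N"
    using cardN by (simp add: card_cartesian_product mult.commute)
  ultimately have "bij_betw \<beta> N ({..<card (N // r)} \<times> {..<k})"
    by (metis bij_betw_def card_image card_subset_eq finite_SigmaI finite_lessThan)
  moreover have "card (N // r) = card N div k" using cardN k by (metis nonzero_mult_div_cancel_left not_gr0)
  ultimately show ?thesis using that fst_iff by metis
qed

lemma compose_quandle_hom:
  assumes "is_quandle Q" "f \<in> quandle_hom Q X" "\<phi> \<in> quandle_hom X Y"
  shows "compose (carrier Q) \<phi> f \<in> quandle_hom Q Y"
  using assms is_quandleD(1)[OF assms(1)]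
  by (auto simp: quandle_hom_def compose_def PiE_iff)

text \<open>Two homomorphisms \<open>f\<close>, \<open>g\<close> that are not constant are joined by an edge precisely if \<open>g\<close> arises
  from \<open>f\<close> by an affine map, which is then unique, as \<open>f\<close> takes two distinct values, and
  invertible, as \<open>g\<close> does.  So being joined is an equivalence relation.  Of the \<open>n\<^sup>2\<close> affine maps
  exactly the \<open>n\<close> constant ones turn \<open>f\<close> into a constant, so each class has
  \<open>n\<^sup>2 - n = n (n - 1)\<close> elements.\<close>

lemma dihedral_quiver_iso:
  fixes Q :: "'a quandle"
  assumes n: "prime n" and Q: "is_quandle Q" and x0: "x0 \<in> carrier Q"
    and fin: "finite (quandle_hom Q (dihedral_quandle n))"
  defines "V \<equiv> quandle_hom Q (dihedral_quandle n)"
  shows "pseudograph_iso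
    \<lparr>verts = V, weight = (\<lambda>f g. card {\<phi> \<in> dihedral_endos n. g = compose (carrier Q) \<phi> f})\<rparr>
    (join_left (complete_graph n n) 1
      (copies ((card V - n) div (n * (n - 1))) (complete_graph (n * (n - 1)) 1)))"
proof -
  let ?Zn = "{0..<int n}" and ?E = "dihedral_endos n"
  have n1: "n > 1" using n prime_gt_1_nat by blast
  define w where "w f g = card {\<phi> \<in> ?E. g = compose (carrier Q) \<phi> f}" for f g
  define const where "const a = (\<lambda>_\<in>carrier Q. a)" for a :: int
  define T where "T = const ` ?Zn"
  define N where "N = V - T"
  note two = bij_betw_dihedral_endo_two_points[OF n]
  have VD: "f \<in> carrier Q \<rightarrow>\<^sub>E ?Zn" if "f \<in> V" for f
    using that by (simp add: V_def quandle_hom_def)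
  have V_range: "f x \<in> ?Zn" if "f \<in> V" "x \<in> carrier Q" for f x
    using PiE_mem[OF VD[OF that(1)] that(2)] .
  have NV: "f \<in> V" if "f \<in> N" for f using that by (simp add: N_def)
  have comp_V: "compose (carrier Q) \<phi> f \<in> V" if "f \<in> V" "\<phi> \<in> ?E" for f \<phi>
    using compose_quandle_hom[OF Q] that unfolding V_def by blast
  have comp_eq: "compose (carrier Q) \<phi> f x = \<phi> (f x)" if "x \<in> carrier Q" for \<phi> f x
    using that by (simp add: compose_def)
  have const_x0: "const a x0 = a" for a using x0 by (simp add: const_def)
  have TV: "T \<subseteq> V"
    using is_quandleD(1)[OF Q] by (auto simp: T_def V_def const_def quandle_hom_def)
  have cardT: "card T = n"
  proof -
    have "inj_on const ?Zn" using const_x0 by (metis inj_onI)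
    then show ?thesis by (simp add: T_def card_image)
  qed
  have nonconst: "\<exists>x\<in>carrier Q. \<exists>y\<in>carrier Q. f x \<noteq> f y" if "f \<in> N" for f
  proof (rule ccontr)
    assume "\<not> ?thesis"
    then have "f x = f x0" if "x \<in> carrier Q" for x using that x0 by blast
    then have "f = const (f x0)"
      using VD[OF NV[OF \<open>f \<in> N\<close>]] by (auto simp: const_def PiE_iff extensional_def)
    moreover have "f x0 \<in> ?Zn" using V_range NV \<open>f \<in> N\<close> x0 by blast
    ultimately show False using \<open>f \<in> N\<close> by (auto simp: N_def T_def)
  qed
  \<comment> \<open>Post-composition with a fixed non-constant \<open>f\<close> is injective on endomorphisms.\<close>
  have endo_eqI: "\<phi> = \<psi>"
    if "\<phi> \<in> ?E" "\<psi> \<in> ?E" "f \<in> N" "compose (carrier Q) \<phi> f = compose (carrier Q) \<psi> f" for \<phi> \<psi> f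
  proof -
    obtain x y where xy: "x \<in> carrier Q" "y \<in> carrier Q" "f x \<noteq> f y"
      using nonconst \<open>f \<in> N\<close> by blast
    have "\<phi> (f x) = \<psi> (f x)" "\<phi> (f y) = \<psi> (f y)"
      using comp_eq xy that(4) by metis+
    moreover have "f x \<in> ?Zn" "f y \<in> ?Zn" using V_range NV \<open>f \<in> N\<close> xy by blast+
    ultimately show ?thesis
      using two xy(3) that(1,2) by (auto simp: bij_betw_def dest!: inj_onD)
  qed
  have endo_const: "(\<lambda>_\<in>?Zn. a) \<in> ?E" if "a \<in> ?Zn" for a
    using affine_dihedral_endo[of n 0 a] n1 that by (simp cong: restrict_cong)
  have comp_const: "compose (carrier Q) (\<lambda>_\<in>?Zn. a) f = const a" if "f \<in> V" for f a
    using V_range[OF that] by (simp add: compose_def const_def fun_eq_iff)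
  have const_comp: "compose (carrier Q) \<phi> (const a) = const (\<phi> a)" for \<phi> a
    by (auto simp: compose_def const_def)
  have w_one: "w f g = 1" if f: "f \<in> N" and "\<phi> \<in> ?E" "g = compose (carrier Q) \<phi> f" for f g \<phi>
  proof -
    have "{\<phi> \<in> ?E. g = compose (carrier Q) \<phi> f} = {\<phi>}"
      using endo_eqI[OF _ _ f] that by blast
    then show ?thesis by (simp add: w_def)
  qed
  have w_zero: "w f g = 0" if "\<And>\<phi>. \<phi> \<in> ?E \<Longrightarrow> g \<noteq> compose (carrier Q) \<phi> f" for f g
  proof -
    have "{\<phi> \<in> ?E. g = compose (carrier Q) \<phi> f} = {}" using that by blast
    then show ?thesis by (simp only: w_def card.empty)
  qed
  have w_TT: "w f g = n" if "f \<in> T" "g \<in> T" for f g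
  proof -
    obtain a b where ab: "f = const a" "g = const b" "a \<in> ?Zn" "b \<in> ?Zn"
      using \<open>f \<in> T\<close> \<open>g \<in> T\<close> by (auto simp: T_def)
    \<comment> \<open>Prescribing only the value at \<open>a\<close> leaves the value at one further point \<open>v\<close> free.\<close>
    define v where "v = (if a = 0 then 1 else 0 :: int)"
    have v: "v \<in> ?Zn" "a \<noteq> v" using n1 by (auto simp: v_def)
    have "g = compose (carrier Q) \<phi> f \<longleftrightarrow> \<phi> a = b" for \<phi>
        unfolding ab(1,2) const_comp using const_x0 by metis
    then have "{\<phi> \<in> ?E. g = compose (carrier Q) \<phi> f} = {\<phi> \<in> ?E. (\<phi> a, \<phi> v) \<in> {b} \<times> ?Zn}"
      using quandle_homD(2) v(1) by fastforce
    moreover have "{b} \<times> ?Zn \<subseteq> ?Zn \<times> ?Zn" using ab(4) by blast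
    note card_preimage_bij_betw[OF two[OF ab(3) v] this]
    ultimately show ?thesis by (simp only: w_def card_cartesian_product) simp
  qed
  have w_TN: "w f g = 0" if "f \<in> T" "g \<in> N" for f g
  proof (rule w_zero)
    fix \<phi> assume \<phi>: "\<phi> \<in> ?E"
    obtain a where a: "f = const a" "a \<in> ?Zn" using \<open>f \<in> T\<close> by (auto simp: T_def)
    then have "compose (carrier Q) \<phi> f \<in> T"
      using const_comp quandle_homD(2)[OF \<phi>] by (auto simp: T_def)
    then show "g \<noteq> compose (carrier Q) \<phi> f" using \<open>g \<in> N\<close> by (auto simp: N_def)
  qed
  have w_NT: "w f g = 1" if "f \<in> N" "g \<in> T" for f g
  proof -
    obtain a where "g = const a" "a \<in> ?Zn" using \<open>g \<in> T\<close> by (auto simp: T_def)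
    then show ?thesis
      using w_one[OF \<open>f \<in> N\<close> endo_const] comp_const \<open>f \<in> N\<close> by (simp add: N_def)
  qed
  define r where "r = {(f, g) \<in> N \<times> N. \<exists>\<phi>\<in>?E. g = compose (carrier Q) \<phi> f}"
  have w_NN: "w f g = (if (f, g) \<in> r then 1 else 0)" if "f \<in> N" "g \<in> N" for f g
    using that w_one[OF that(1)] w_zero by (auto simp: r_def)
  have comp_comp: "compose (carrier Q) (compose ?Zn \<psi> \<phi>) f =
      compose (carrier Q) \<psi> (compose (carrier Q) \<phi> f)" if "f \<in> V" for \<psi> \<phi> f
    using V_range[OF that] by (simp add: compose_def fun_eq_iff)
  have endo_comp: "compose ?Zn \<psi> \<phi> \<in> ?E" if "\<phi> \<in> ?E" "\<psi> \<in> ?E" for \<phi> \<psi>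
    using compose_quandle_hom[OF is_quandle_dihedral that] by simp
  have endo_id: "(\<lambda>x\<in>?Zn. x) \<in> ?E"
    using affine_dihedral_endo[of n 1 0] n1 by (simp cong: restrict_cong)
  have comp_id: "compose (carrier Q) (\<lambda>x\<in>?Zn. x) f = f" if "f \<in> V" for f
    using VD[OF that] by (auto simp: compose_def fun_eq_iff PiE_iff extensional_def)
  have r: "equiv N r"
  proof (rule equivI)
    show "r \<subseteq> N \<times> N" by (auto simp: r_def)
    show "refl_on N r"
    proof (rule refl_onI)
      fix f assume f: "f \<in> N"
      then have "f = compose (carrier Q) (\<lambda>x\<in>?Zn. x) f" using comp_id[OF NV] by simp
      then show "(f, f) \<in> r" using f endo_id unfolding r_def by blast
    qed
    show "trans r"
    proof (rule transI)
      fix f g h assume "(f, g) \<in> r" "(g, h) \<in> r"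
      then obtain \<phi> \<psi> where *: "f \<in> N" "h \<in> N" "\<phi> \<in> ?E" "\<psi> \<in> ?E"
        "g = compose (carrier Q) \<phi> f" "h = compose (carrier Q) \<psi> g"
        by (auto simp: r_def)
      from *(5,6) have "h = compose (carrier Q) (compose ?Zn \<psi> \<phi>) f"
        using comp_comp[OF NV[OF *(1)], of \<psi> \<phi>] by simp
      then show "(f, h) \<in> r" using * endo_comp unfolding r_def by blast
    qed
    show "sym r"
    proof (rule symI)
      fix f g assume "(f, g) \<in> r"
      then obtain \<phi> where f: "f \<in> N" and g: "g \<in> N" and \<phi>: "\<phi> \<in> ?E"
        and gf: "g = compose (carrier Q) \<phi> f" by (auto simp: r_def)
      obtain x y where xy: "x \<in> carrier Q" "y \<in> carrier Q" "g x \<noteq> g y" using nonconst g by blast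
      have fx: "f x \<in> ?Zn" "f y \<in> ?Zn" "f \<in> V" using f xy V_range NV by blast+
      have gx: "g x \<in> ?Zn" "g y \<in> ?Zn" using g xy V_range NV by blast+
      have g\<phi>: "g x = \<phi> (f x)" "g y = \<phi> (f y)" using gf comp_eq xy by simp_all
      then have fxy: "f x \<noteq> f y" using xy(3) by auto
      from two[OF gx xy(3)] fx have "(f x, f y) \<in> (\<lambda>\<psi>. (\<psi> (g x), \<psi> (g y))) ` ?E"
        by (simp add: bij_betw_def)
      then obtain \<psi> where \<psi>: "\<psi> \<in> ?E" "\<psi> (g x) = f x" "\<psi> (g y) = f y" by auto
      \<comment> \<open>The affine map \<open>\<psi>\<close> inverts \<open>\<phi>\<close>: the composite has two fixed points, so it is the
      identity.\<close>
      have "\<psi> (\<phi> (f x)) = f x" "\<psi> (\<phi> (f y)) = f y" using \<psi>(2,3) g\<phi> by simp_all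
      then have "compose ?Zn \<psi> \<phi> = (\<lambda>x\<in>?Zn. x)"
        using fx(1,2)
        by (intro inj_onD[OF bij_betw_imp_inj_on[OF two[OF fx(1,2) fxy]] _
              endo_comp[OF \<phi> \<psi>(1)] endo_id]) (simp add: compose_eq)
      then have "compose (carrier Q) \<psi> g = f"
        using comp_comp[OF fx(3), of \<psi> \<phi>] comp_id[OF fx(3)] gf by simp
      then show "(g, f) \<in> r" using f g \<psi>(1) by (auto simp: r_def)
    qed
  qed
  have card_E: "card ?E = n * n"
    using bij_betw_same_card[OF two[of 0 1]] n1 by (simp add: card_cartesian_product)
  have classes: "card (r `` {f}) = n * (n - 1)" if f: "f \<in> N" for f
  proof -
    have fV: "f \<in> V" using f by (simp add: N_def)
    have "inj_on (\<lambda>\<phi>. compose (carrier Q) \<phi> f) ?E"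
      using endo_eqI[OF _ _ f] by (blast intro: inj_onI)
    then have "card ((\<lambda>\<phi>. compose (carrier Q) \<phi> f) ` ?E) = n * n"
      by (simp add: card_image card_E)
    moreover have "T \<subseteq> (\<lambda>\<phi>. compose (carrier Q) \<phi> f) ` ?E"
    proof
      fix g assume "g \<in> T"
      then obtain a where "g = const a" "a \<in> ?Zn" by (auto simp: T_def)
      then show "g \<in> (\<lambda>\<phi>. compose (carrier Q) \<phi> f) ` ?E"
        using endo_const comp_const[OF fV] by (metis image_eqI)
    qed
    moreover have "r `` {f} = (\<lambda>\<phi>. compose (carrier Q) \<phi> f) ` ?E - T"
      using comp_V[OF fV] f by (auto simp: r_def N_def)
    moreover have "finite T" by (simp add: T_def)
    ultimately have "card (r `` {f}) = n * n - n" by (simp add: card_Diff_subset cardT)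
    then show ?thesis by (simp add: diff_mult_distrib2)
  qed
  have finN: "finite N" using fin by (simp add: N_def V_def)
  have "n * (n - 1) > 0" using n1 by simp
  then obtain \<beta> where \<beta>: "bij_betw \<beta> N ({..<card N div (n * (n - 1))} \<times> {..<n * (n - 1)})"
    and \<beta>_iff: "\<And>f g. f \<in> N \<Longrightarrow> g \<in> N \<Longrightarrow> fst (\<beta> f) = fst (\<beta> g) \<longleftrightarrow> (f, g) \<in> r"
    using equiv_class_coordinates[OF finN r _ classes] by metis
  have cardN: "card N = card V - n"
    using TV cardT by (simp add: N_def card_Diff_subset T_def)
  define \<pi> where "\<pi> f = (if f \<in> T then Inl (nat (f x0)) else Inr (\<beta> f))" for f
  have \<alpha>: "bij_betw (\<lambda>f. nat (f x0)) T {..<n}"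
  proof (rule bij_betw_imageI)
    show "inj_on (\<lambda>f. nat (f x0)) T"
      by (rule inj_onI) (auto simp: T_def const_x0 eq_nat_nat_iff)
    have "k \<in> (\<lambda>f. nat (f x0)) ` T" if "k < n" for k
      by (rule image_eqI[of _ _ "const (int k)"]) (use that const_x0 in \<open>auto simp: T_def\<close>)
    moreover have "nat (f x0) < n" if "f \<in> T" for f
      using that const_x0 n1 by (auto simp: T_def)
    ultimately show "(\<lambda>f. nat (f x0)) ` T = {..<n}" by blast
  qed
  have \<pi>_bij: "bij_betw \<pi> V
      ({..<n} <+> {..<card N div (n * (n - 1))} \<times> {..<n * (n - 1)})"
  proof -
    have "bij_betw \<pi> T (Inl ` {..<n})"
      using \<alpha> unfolding \<pi>_def bij_betw_def by (auto simp: inj_on_def image_iff)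
    moreover have "bij_betw \<pi> N (Inr ` ({..<card N div (n * (n - 1))} \<times> {..<n * (n - 1)}))"
    proof -
      have "bij_betw (Inr \<circ> \<beta>) N (Inr ` ({..<card N div (n * (n - 1))} \<times> {..<n * (n - 1)}))"
        by (rule bij_betw_trans[OF \<beta>]) (simp add: bij_betw_def)
      then show ?thesis
        by (rule iffD1[OF bij_betw_cong, rotated]) (simp add: \<pi>_def N_def)
    qed
    ultimately have "bij_betw \<pi> (T \<union> N)
        (Inl ` {..<n} \<union> Inr ` ({..<card N div (n * (n - 1))} \<times> {..<n * (n - 1)}))"
      by (rule bij_betw_combine) auto
    moreover have "T \<union> N = V" using TV by (auto simp: N_def)
    ultimately show ?thesis by (simp add: Plus_def)
  qed
  show ?thesis
    unfolding pseudograph_iso_def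
  proof (intro exI[of _ \<pi>] conjI ballI)
    show "bij_betw \<pi> (verts \<lparr>verts = V,
          weight = \<lambda>f g. card {\<phi> \<in> ?E. g = compose (carrier Q) \<phi> f}\<rparr>)
        (verts (join_left (complete_graph n n) 1
          (copies ((card V - n) div (n * (n - 1))) (complete_graph (n * (n - 1)) 1))))"
      using \<pi>_bij by (simp add: join_left_def copies_def complete_graph_def cardN)
  next
    fix f g
    assume "f \<in> verts \<lparr>verts = V, weight = \<lambda>f g. card {\<phi> \<in> ?E. g = compose (carrier Q) \<phi> f}\<rparr>"
      and "g \<in> verts \<lparr>verts = V, weight = \<lambda>f g. card {\<phi> \<in> ?E. g = compose (carrier Q) \<phi> f}\<rparr>"
    then have fg: "f \<in> T \<or> f \<in> N \<and> f \<notin> T" "g \<in> T \<or> g \<in> N \<and> g \<notin> T"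
      by (auto simp: N_def)
    have "weight (join_left (complete_graph n n) 1
        (copies q (complete_graph (n * (n - 1)) 1))) (\<pi> f) (\<pi> g) = w f g" for q
      using fg w_TT[of f g] w_TN[of f g] w_NT[of f g] w_NN[of f g] \<beta>_iff[of f g]
      by (auto simp: \<pi>_def join_left_def copies_def complete_graph_def split: prod.split)
    then show "weight (join_left (complete_graph n n) 1
        (copies ((card V - n) div (n * (n - 1))) (complete_graph (n * (n - 1)) 1))) (\<pi> f) (\<pi> g) =
      weight \<lparr>verts = V, weight = \<lambda>f g. card {\<phi> \<in> ?E. g = compose (carrier Q) \<phi> f}\<rparr> f g"
      by (simp add: w_def)
  qed
qed


section \<open>Fox colorings of a pretzel diagram\<close>

text \<open>Here \<open>x i\<close> is the color of the upper left end of the tangle \<open>i\<close>, which is joined to the upper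
  right end of the preceding tangle.  That the differences \<open>x (i + 1) - x i\<close> add up to zero
  around the link is implicit in the cyclic index.\<close>

definition pretzel_solutions :: "nat \<Rightarrow> nat \<Rightarrow> (nat \<Rightarrow> int) \<Rightarrow> (nat \<Rightarrow> int) set" where
  "pretzel_solutions n m p = {x \<in> {..<m} \<rightarrow>\<^sub>E {0..<int n}. \<forall>i<m.
     [p i * (x (Suc i mod m) - x i) = p 0 * (x (Suc 0 mod m) - x 0)] (mod int n)}"

lemma succ_pred_mod:
  fixes i m :: nat
  assumes "i < m"
  shows "Suc ((i + m - Suc 0) mod m) mod m = i"
  using assms by (cases i) simp_all

text \<open>If the upper ends of a crossing have the colors \<open>a\<close>, \<open>b\<close>, then its lower ends have the colors
  \<open>b\<close>, \<open>2 b - a\<close> if the rising strand is on top, and \<open>2 a - b\<close>, \<open>a\<close> otherwise.  In both cases the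
  difference is kept and the pair is translated by \<open>\<epsilon> (b - a)\<close> with a sign \<open>\<epsilon>\<close>, so \<open>x\<close> determines
  all colors.  At the bottom of the tangles \<open>i\<close> and \<open>i + 1\<close> the colors
  \<open>x (i + 1) + \<epsilon> p\<^sub>i d\<^sub>i\<close> and \<open>x (i + 1) + \<epsilon> p\<^sub>i\<^sub>+\<^sub>1 d\<^sub>i\<^sub>+\<^sub>1\<close> have to agree.\<close>

lemma bij_betw_pretzel_solutions:
  assumes n: "n > 0" and m: "m > 0" and p: "\<forall>i<m. p i > 0"
  shows "bij_betw (\<lambda>\<gamma>. \<lambda>i\<in>{..<m}. \<gamma> ((i, 0), NW))
    (fox_colorings n (pretzel_diagram s m p)) (pretzel_solutions n m p)"
    (is "bij_betw ?F ?A ?B")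
proof -
  define \<epsilon> :: int where "\<epsilon> = (case s of Rising \<Rightarrow> 1 | Falling \<Rightarrow> -1)"
  \<comment> \<open>The colors, as integers before reduction, that \<open>x\<close> forces at the crossing \<open>(i, k)\<close>.\<close>
  define col where "col x i k u =
      (case u of
        NW \<Rightarrow> x i + \<epsilon> * int k * (x (Suc i mod m) - x i)
      | NE \<Rightarrow> x (Suc i mod m) + \<epsilon> * int k * (x (Suc i mod m) - x i)
      | SW \<Rightarrow> x i + \<epsilon> * (int k + 1) * (x (Suc i mod m) - x i)
      | SE \<Rightarrow> x (Suc i mod m) + \<epsilon> * (int k + 1) * (x (Suc i mod m) - x i))"
    for x :: "nat \<Rightarrow> int" and i k u
  let ?D = "pretzel_diagram s m p"
  have ends: "((i, k), u) \<in> ends ?D \<longleftrightarrow> i < m \<and> k < nat (p i)" for i k u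
    using p by (auto simp: ends_def pretzel_diagram_def)
  have crossings: "(i, k) \<in> crossings ?D \<longleftrightarrow> i < m \<and> k < nat (p i)" for i k
    using p by (auto simp: pretzel_diagram_def)
  have over: "over ?D (i, k) = s" if "i < m" for i k
    using p that by (simp add: pretzel_diagram_def)
  have glue: "glue ?D = pretzel_glue m p" by (simp add: pretzel_diagram_def)
  have pos: "nat (p i) > 0" if "i < m" for i using p that by simp
  have col_next: "[a = col x i k NW] (mod int n) \<Longrightarrow> [b = col x i k NE] (mod int n) \<Longrightarrow>
      [(if s = Rising then b else 2 * a - b) = col x i k SW] (mod int n) \<and>
      [(if s = Rising then 2 * b - a else a) = col x i k SE] (mod int n)" for a b x i k
  proof (cases s)
    case Rising
    assume ab: "[a = col x i k NW] (mod int n)" "[b = col x i k NE] (mod int n)"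
    have "col x i k NE = col x i k SW" "2 * col x i k NE - col x i k NW = col x i k SE"
      by (simp_all add: col_def \<epsilon>_def Rising algebra_simps)
    moreover have "[2 * b - a = 2 * col x i k NE - col x i k NW] (mod int n)"
      by (intro cong_diff cong_mult ab cong_refl)
    ultimately show ?thesis using ab(2) Rising by simp
  next
    case Falling
    assume ab: "[a = col x i k NW] (mod int n)" "[b = col x i k NE] (mod int n)"
    have "col x i k NW = col x i k SE" "2 * col x i k NW - col x i k NE = col x i k SW"
      by (simp_all add: col_def \<epsilon>_def Falling algebra_simps)
    moreover have "[2 * a - b = 2 * col x i k NW - col x i k NE] (mod int n)"
      by (intro cong_diff cong_mult ab cong_refl)
    ultimately show ?thesis using ab(1) Falling by simp
  qed
  have fox_ends: "\<gamma> e \<in> {0..<int n}" if "\<gamma> \<in> ?A" "e \<in> ends ?D" for \<gamma> e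
    using that by (auto simp: fox_colorings_def)
  have fox_glue: "\<gamma> (pretzel_glue m p e) = \<gamma> e" if "\<gamma> \<in> ?A" "e \<in> ends ?D" for \<gamma> e
    using that by (auto simp: fox_colorings_def glue)
  have fox_bottom: "[\<gamma> ((i, k), SW) = (if s = Rising then \<gamma> ((i, k), NE)
        else 2 * \<gamma> ((i, k), NW) - \<gamma> ((i, k), NE))] (mod int n)"
    "[\<gamma> ((i, k), SE) = (if s = Rising then 2 * \<gamma> ((i, k), NE) - \<gamma> ((i, k), NW)
        else \<gamma> ((i, k), NW))] (mod int n)"
    if g: "\<gamma> \<in> ?A" and i: "i < m" and k: "k < nat (p i)" for \<gamma> i k
  proof -
    have fox: "\<forall>c\<in>crossings ?D. \<forall>u. slope_of u = over ?D c \<longrightarrow> \<gamma> (c, opposite u) = \<gamma> (c, u) \<and>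
        [\<gamma> (c, clockwise u) + \<gamma> (c, opposite (clockwise u)) = 2 * \<gamma> (c, u)] (mod int n)"
      using g unfolding fox_colorings_def by (elim CollectE conjE)
    have rel: "\<gamma> ((i, k), opposite u) = \<gamma> ((i, k), u)"
      "[\<gamma> ((i, k), clockwise u) + \<gamma> ((i, k), opposite (clockwise u)) = 2 * \<gamma> ((i, k), u)]
        (mod int n)" if "slope_of u = s" for u
      using bspec[OF fox, of "(i, k)"] that i k by (simp_all add: over crossings)
    have move: "[a = c - b] (mod int n)" if "[a + b = c] (mod int n)" for a b c
      using cong_diff[OF that cong_refl[of b]] by simp
    show "[\<gamma> ((i, k), SW) = (if s = Rising then \<gamma> ((i, k), NE)
        else 2 * \<gamma> ((i, k), NW) - \<gamma> ((i, k), NE))] (mod int n)"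
      using rel[of NE] rel[of NW] move[of "\<gamma> ((i, k), SW)" "\<gamma> ((i, k), NE)" "2 * \<gamma> ((i, k), NW)"]
      by (cases s) (simp_all add: add.commute)
    show "[\<gamma> ((i, k), SE) = (if s = Rising then 2 * \<gamma> ((i, k), NE) - \<gamma> ((i, k), NW)
        else \<gamma> ((i, k), NW))] (mod int n)"
      using rel[of NE] rel[of NW] move[of "\<gamma> ((i, k), SE)" "\<gamma> ((i, k), NW)" "2 * \<gamma> ((i, k), NE)"]
      by (cases s) (simp_all add: add.commute)
  qed
  have top: "[\<gamma> ((i, k), NW) = col (?F \<gamma>) i k NW] (mod int n) \<and>
      [\<gamma> ((i, k), NE) = col (?F \<gamma>) i k NE] (mod int n)"
    if g: "\<gamma> \<in> ?A" and i: "i < m" and k: "k < nat (p i)" for \<gamma> i k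
    using k
  proof (induction k)
    case 0
    have "\<gamma> ((i, 0), NE) = \<gamma> ((Suc i mod m, 0), NW)"
      using fox_glue[OF g, of "((i, 0), NE)"] i 0 by (simp add: ends)
    then show ?case using i m by (simp add: col_def)
  next
    case (Suc k)
    have "\<gamma> ((i, Suc k), NW) = \<gamma> ((i, k), SW)" "\<gamma> ((i, Suc k), NE) = \<gamma> ((i, k), SE)"
      using fox_glue[OF g, of "((i, Suc k), NW)"] fox_glue[OF g, of "((i, Suc k), NE)"] i Suc.prems
      by (simp_all add: ends)
    moreover have "col (?F \<gamma>) i (Suc k) NW = col (?F \<gamma>) i k SW"
      "col (?F \<gamma>) i (Suc k) NE = col (?F \<gamma>) i k SE"
      by (simp_all add: col_def algebra_simps)
    moreover have k: "k < nat (p i)" using Suc.prems by simp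
    note IH = Suc.IH[OF k, THEN conjunct1] Suc.IH[OF k, THEN conjunct2]
    have "[\<gamma> ((i, k), SW) = col (?F \<gamma>) i k SW] (mod int n)"
      "[\<gamma> ((i, k), SE) = col (?F \<gamma>) i k SE] (mod int n)"
      using fox_bottom[OF g i k] col_next[OF IH] by (blast intro: cong_trans)+
    ultimately show ?case by (simp only:)
  qed
  have fox_col: "[\<gamma> ((i, k), u) = col (?F \<gamma>) i k u] (mod int n)"
    if "\<gamma> \<in> ?A" "i < m" "k < nat (p i)" for \<gamma> i k u
  proof -
    note IH = top[OF that, THEN conjunct1] top[OF that, THEN conjunct2]
    show ?thesis
      using IH fox_bottom[OF that] col_next[OF IH] by (cases u) (blast intro: cong_trans)+
  qed
  show ?thesis
  proof (rule bij_betw_imageI)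
    show "inj_on ?F ?A"
    proof (rule inj_onI)
      fix \<gamma> \<delta> assume g: "\<gamma> \<in> ?A" "\<delta> \<in> ?A" and eq: "?F \<gamma> = ?F \<delta>"
      have "\<gamma> e = \<delta> e" if e: "e \<in> ends ?D" for e
      proof -
        obtain i k u where iku: "e = ((i, k), u)" by (metis surj_pair)
        then have ik: "i < m" "k < nat (p i)" using e ends by auto
        show ?thesis
        proof (rule cong_residues_eq[OF _ fox_ends[OF g(1) e] fox_ends[OF g(2) e]])
          show "[\<gamma> e = \<delta> e] (mod int n)"
            using fox_col[OF g(1) ik] fox_col[OF g(2) ik] eq unfolding iku
            by (metis cong_sym cong_trans)
        qed
      qed
      moreover have "\<gamma> \<in> ends ?D \<rightarrow>\<^sub>E {0..<int n}" "\<delta> \<in> ends ?D \<rightarrow>\<^sub>E {0..<int n}"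
        using g by (auto simp: fox_colorings_def)
      ultimately show "\<gamma> = \<delta>" by (blast intro: PiE_ext)
    qed
    show "?F ` ?A = ?B"
    proof (intro equalityI subsetI)
      fix x assume "x \<in> ?F ` ?A"
      then obtain \<gamma> where g: "\<gamma> \<in> ?A" and x: "x = ?F \<gamma>" by blast
      have xE: "x \<in> {..<m} \<rightarrow>\<^sub>E {0..<int n}"
      proof
        fix i assume "i \<in> {..<m}"
        then show "x i \<in> {0..<int n}"
          using fox_ends[OF g, of "((i, 0), NW)"] pos by (simp add: x ends)
      qed (simp add: x)
      define d where "d i = p i * (x (Suc i mod m) - x i)" for i
      have adjacent: "[d i = d (Suc i)] (mod int n)" if i: "Suc i < m" for i
      proof -
        have k: "nat (p i) - 1 < nat (p i)" "nat (p (Suc i)) - 1 < nat (p (Suc i))"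
          using pos[of i] pos[of "Suc i"] i by simp_all
        have int_k: "int (nat (p i) - 1) + 1 = p i"
          "int (nat (p (Suc i)) - 1) + 1 = p (Suc i)"
          using p[rule_format, of i] p[rule_format, of "Suc i"] i by simp_all
        have "\<gamma> ((i, nat (p i) - 1), SE) = \<gamma> ((Suc i, nat (p (Suc i)) - 1), SW)"
          using fox_glue[OF g, of "((i, nat (p i) - 1), SE)"] i k p[rule_format, of "Suc i"]
            p[rule_format, of i] by (simp add: ends)
        then have "[col x i (nat (p i) - 1) SE = col x (Suc i) (nat (p (Suc i)) - 1) SW] (mod int n)"
          using fox_col[OF g Suc_lessD[OF i] k(1), of SE, folded x]
            fox_col[OF g i k(2), of SW, folded x] by (simp add: cong_def)
        then have "[x (Suc i) + \<epsilon> * d i = x (Suc i) + \<epsilon> * d (Suc i)] (mod int n)"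
          using i int_k by (simp add: col_def d_def mult.assoc)
        then have "[\<epsilon> * d i = \<epsilon> * d (Suc i)] (mod int n)"
          by (simp add: cong_add_lcancel)
        from cong_scalar_left[OF this, of \<epsilon>] show ?thesis
          by (cases s) (simp_all add: \<epsilon>_def)
      qed
      have "[d i = d 0] (mod int n)" if "i < m" for i
        using that
      proof (induction i)
        case (Suc i)
        then show ?case using adjacent[of i] by (meson Suc_lessD cong_sym cong_trans)
      qed simp
      then show "x \<in> ?B"
        using xE by (simp add: pretzel_solutions_def d_def)
    next
      fix x assume x: "x \<in> ?B"
      then have xE: "x \<in> {..<m} \<rightarrow>\<^sub>E {0..<int n}" by (simp add: pretzel_solutions_def)
      have x_res: "x i mod int n = x i" if "i < m" for i
        using PiE_mem[OF xE, of i] that by simp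
      have d: "[p i * (x (Suc i mod m) - x i) = p j * (x (Suc j mod m) - x j)] (mod int n)"
        if "i < m" "j < m" for i j
        using x that by (simp add: pretzel_solutions_def cong_def)
      define \<gamma> where "\<gamma> = (\<lambda>((i, k), u) \<in> ends ?D. col x i k u mod int n)"
      have \<gamma>: "\<gamma> ((i, k), u) = col x i k u mod int n" if "i < m" "k < nat (p i)" for i k u
        using that by (simp add: \<gamma>_def ends)
      have "\<gamma> \<in> ?A"
        unfolding fox_colorings_def
      proof (intro CollectI conjI ballI allI impI)
        show "\<gamma> \<in> ends ?D \<rightarrow>\<^sub>E {0..<int n}" using n by (auto simp: \<gamma>_def)
      next
        fix e assume e: "e \<in> ends ?D"
        obtain i k u where iku: "e = ((i, k), u)" by (metis surj_pair)
        then have i: "i < m" and k: "k < nat (p i)" using e ends by auto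
        define j where "j = (i + m - Suc 0) mod m"
        have j: "j < m" "Suc j mod m = i" using succ_pred_mod i by (auto simp: j_def)
        \<comment> \<open>The only place where gluing imposes a condition on \<open>x\<close>.\<close>
        have bottom: "col x a (nat (p a) - 1) SE mod int n =
            col x (Suc a mod m) (nat (p (Suc a mod m)) - 1) SW mod int n" if a: "a < m" for a
        proof -
          define b where "b = Suc a mod m"
          have b: "b < m" using a by (simp add: b_def)
          have "[x b + \<epsilon> * (p a * (x b - x a)) = x b + \<epsilon> * (p b * (x (Suc b mod m) - x b))] (mod int n)"
            using cong_add[OF cong_refl cong_scalar_left[OF d[OF a b]]] by (simp only: b_def)
          moreover have "int (nat (p a) - 1) + 1 = p a" "int (nat (p b) - 1) + 1 = p b"
            using p[rule_format, OF a] p[rule_format, OF b] by simp_all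
          ultimately show ?thesis
            by (simp add: col_def cong_def mult.assoc flip: b_def)
        qed
        show "\<gamma> (glue ?D e) = \<gamma> e"
        proof (cases u)
          case NW
          show ?thesis
          proof (cases k)
            case 0
            have "col x j 0 NE = col x i 0 NW" using j by (simp add: col_def)
            then show ?thesis using i k j pos[OF j(1)] 0 NW
              by (simp add: iku glue \<gamma> flip: j_def)
          next
            case (Suc k')
            then show ?thesis using i k NW by (simp add: iku glue \<gamma> col_def algebra_simps)
          qed
        next
          case NE
          show ?thesis
          proof (cases k)
            case 0
            then show ?thesis using i k pos[of "Suc i mod m"] NE
              by (simp add: iku glue \<gamma> col_def)
          next
            case (Suc k')
            then show ?thesis using i k NE by (simp add: iku glue \<gamma> col_def algebra_simps)
          qed
        next
          case SW
          show ?thesis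
          proof (cases "Suc k < nat (p i)")
            case True
            then show ?thesis using i k SW p by (simp add: iku glue \<gamma> col_def algebra_simps)
          next
            case False
            then have "k = nat (p i) - 1" using k by simp
            then show ?thesis
              using i k SW False bottom[OF j(1)] j p[rule_format, OF i] p[rule_format, OF j(1)] pos[OF j(1)]
              by (simp add: iku glue \<gamma> Let_def flip: j_def)
          qed
        next
          case SE
          show ?thesis
          proof (cases "Suc k < nat (p i)")
            case True
            then show ?thesis using i k SE p by (simp add: iku glue \<gamma> col_def algebra_simps)
          next
            case False
            then have k_eq: "k = nat (p i) - 1" using k by simp
            have i': "Suc i mod m < m" using i by simp
            show ?thesis
              using i k SE False bottom[OF i] i' k_eq p[rule_format, OF i] p[rule_format, OF i'] pos[OF i']
              by (simp add: iku glue \<gamma> Let_def)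
          qed
        qed
      next
        fix c u assume "c \<in> crossings ?D" and u: "slope_of u = over ?D c"
        then obtain i k where c: "c = (i, k)" "i < m" "k < nat (p i)"
          using crossings by (metis surj_pair)
        then have u: "slope_of u = s" using u over by simp
        show "\<gamma> (c, opposite u) = \<gamma> (c, u)"
          using c(2,3) u unfolding c(1)
          by (cases s; cases u) (simp_all add: \<gamma> col_def \<epsilon>_def algebra_simps)
        have "col x i k (clockwise u) + col x i k (opposite (clockwise u)) = 2 * col x i k u"
          using u by (cases s; cases u) (simp_all add: col_def \<epsilon>_def algebra_simps)
        then show "[\<gamma> (c, clockwise u) + \<gamma> (c, opposite (clockwise u)) = 2 * \<gamma> (c, u)] (mod int n)"
          using c(2,3) unfolding c(1) by (simp add: \<gamma> cong_def mod_add_eq mod_mult_right_eq)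
      qed
      moreover have "?F \<gamma> = x"
      proof (rule PiE_ext[OF _ xE])
        show "?F \<gamma> i = x i" if "i \<in> {..<m}" for i
          using that pos x_res by (simp add: \<gamma> col_def)
        then show "?F \<gamma> \<in> {..<m} \<rightarrow>\<^sub>E {0..<int n}" using xE by (auto simp: PiE_iff)
      qed
      ultimately show "x \<in> ?F ` ?A" by blast
    qed
  qed
qed


section \<open>Counting the colorings of a pretzel link\<close>

text \<open>A single \<open>p\<^sub>z\<close> divisible by \<open>n\<close> forces the common value of the \<open>p\<^sub>i (x\<^sub>i\<^sub>+\<^sub>1 - x\<^sub>i)\<close> to vanish.  Then
  \<open>x\<close> may change only directly after an index in \<open>Z\<close>, and a solution is given by its
  values on \<open>Z\<close>, which are arbitrary.\<close>

lemma card_pretzel_solutions_vanishing: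
  assumes n: "prime n" and Z: "Z = {i. i < m \<and> int n dvd p i}" "Z \<noteq> {}"
  shows "card (pretzel_solutions n m p) = n ^ card Z"
proof -
  let ?Zn = "{0..<int n}"
  have n1: "n > 1" using n prime_gt_1_nat by blast
  obtain z where z: "z \<in> Z" "z < m" using Z by blast
  \<comment> \<open>The first element of \<open>Z\<close> at or after \<open>i\<close> in cyclic order; \<open>x\<close> is constant from \<open>i\<close> to there.\<close>
  define r where "r i = (i + (LEAST t. (i + t) mod m \<in> Z)) mod m" for i
  have m: "m > 0" using z by simp
  have reach: "\<exists>t. (i + t) mod m \<in> Z" if "i < m" for i
    \<comment> \<open>From \<open>i\<close> one walks to the end of the cycle and on to \<open>z\<close>.\<close>
    by (rule exI[of _ "m - i + z"]) (use that z in simp)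
  have rZ: "r i \<in> Z" if "i < m" for i
    unfolding r_def by (rule LeastI_ex[OF reach[OF that]])
  have r_id: "r i = i" if "i \<in> Z" for i
  proof -
    have "i < m" using that Z by simp
    then have "(LEAST t. (i + t) mod m \<in> Z) = 0" using that by (intro Least_equality) simp_all
    then show ?thesis using \<open>i < m\<close> by (simp add: r_def)
  qed
  have r_step: "r i = r (Suc i mod m)" if i: "i < m" "i \<notin> Z" for i
  proof -
    obtain t where t: "(i + t) mod m \<in> Z" using reach[OF i(1)] by blast
    have "\<not> (i + 0) mod m \<in> Z" using i by simp
    from Least_Suc[of "\<lambda>t. (i + t) mod m \<in> Z", OF t this]
    show ?thesis by (simp add: r_def mod_add_left_eq)
  qed
  have const: "x i = x (r i)"
    if step: "\<And>i. i < m \<Longrightarrow> i \<notin> Z \<Longrightarrow> x (Suc i mod m) = x i" and "i < m" for x :: "nat \<Rightarrow> int" and i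
  proof -
    have "x ((i + t) mod m) = x i" if "\<And>s. s < t \<Longrightarrow> (i + s) mod m \<notin> Z" for t
      using that
    proof (induction t)
      case 0
      then show ?case using \<open>i < m\<close> by simp
    next
      case (Suc t)
      have "x (Suc ((i + t) mod m) mod m) = x ((i + t) mod m)"
        using Suc.prems[of t] m by (intro step) simp_all
      then show ?case using Suc by (simp add: mod_Suc_eq)
    qed
    then show ?thesis unfolding r_def using not_less_Least by metis
  qed
  have sol_iff: "x \<in> pretzel_solutions n m p \<longleftrightarrow>
      (\<forall>i<m. i \<notin> Z \<longrightarrow> x (Suc i mod m) = x i)" if x: "x \<in> {..<m} \<rightarrow>\<^sub>E ?Zn" for x
  proof
    assume sol: "x \<in> pretzel_solutions n m p"
    show "\<forall>i<m. i \<notin> Z \<longrightarrow> x (Suc i mod m) = x i"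
    proof (intro allI impI)
      fix i assume i: "i < m" "i \<notin> Z"
      have "[p z * (x (Suc z mod m) - x z) = 0] (mod int n)"
        using z Z by (simp add: cong_0_iff)
      moreover have "[p j * (x (Suc j mod m) - x j) = p 0 * (x (Suc 0 mod m) - x 0)] (mod int n)"
        if "j < m" for j
        using sol that by (auto simp: pretzel_solutions_def)
      ultimately have "[p i * (x (Suc i mod m) - x i) = 0] (mod int n)"
        using i(1) z(2) by (meson cong_sym cong_trans)
      then have "[p i * (x (Suc i mod m) - x i) = p i * 0] (mod int n)" by simp
      then have "[x (Suc i mod m) - x i = 0] (mod int n)"
        using prime_cong_mult_cancel[OF n] i Z by blast
      then have "[x (Suc i mod m) = x i] (mod int n)"
        using cong_diff_iff_cong_0 by blast
      then show "x (Suc i mod m) = x i"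
        by (rule cong_residues_eq) (use x i m in \<open>auto simp: PiE_iff\<close>)
    qed
  next
    assume step: "\<forall>i<m. i \<notin> Z \<longrightarrow> x (Suc i mod m) = x i"
    have "[p i * (x (Suc i mod m) - x i) = 0] (mod int n)" if "i < m" for i
      using that step Z by (cases "i \<in> Z") (simp_all add: cong_0_iff)
    then have "[p i * (x (Suc i mod m) - x i) = p 0 * (x (Suc 0 mod m) - x 0)] (mod int n)"
      if "i < m" for i
      using that m by (meson cong_sym cong_trans)
    then show "x \<in> pretzel_solutions n m p"
      using x by (simp add: pretzel_solutions_def)
  qed
  have sub: "pretzel_solutions n m p \<subseteq> {..<m} \<rightarrow>\<^sub>E ?Zn"
    by (auto simp: pretzel_solutions_def)
  have "bij_betw (\<lambda>x. restrict x Z) (pretzel_solutions n m p) (Z \<rightarrow>\<^sub>E ?Zn)"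
  proof (rule bij_betw_imageI)
    show "inj_on (\<lambda>x. restrict x Z) (pretzel_solutions n m p)"
    proof (rule inj_onI)
      fix x y assume xy: "x \<in> pretzel_solutions n m p" "y \<in> pretzel_solutions n m p"
        and eq: "restrict x Z = restrict y Z"
      have on_Z: "x i = y i" if "i \<in> Z" for i using fun_cong[OF eq, of i] that by simp
      have "x i = y i" if "i < m" for i
      proof -
        have "x i = x (r i)" "y i = y (r i)"
          using const[of x, OF _ that] const[of y, OF _ that] sol_iff sub xy by blast+
        then show ?thesis using on_Z rZ[OF that] by simp
      qed
      then show "x = y"
        using xy sub by (intro PiE_ext[of x "{..<m}" "\<lambda>_. ?Zn" y]) auto
    qed
    show "(\<lambda>x. restrict x Z) ` pretzel_solutions n m p = Z \<rightarrow>\<^sub>E ?Zn"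
    proof (intro equalityI subsetI)
      fix y assume "y \<in> (\<lambda>x. restrict x Z) ` pretzel_solutions n m p"
      then show "y \<in> Z \<rightarrow>\<^sub>E ?Zn" using sub Z by (fastforce simp: PiE_iff)
    next
      fix y assume y: "y \<in> Z \<rightarrow>\<^sub>E ?Zn"
      define x where "x = (\<lambda>i\<in>{..<m}. y (r i))"
      have "x \<in> {..<m} \<rightarrow>\<^sub>E ?Zn" using y rZ by (auto simp: x_def)
      then have "x \<in> pretzel_solutions n m p"
        using sol_iff[of x] r_step m by (simp add: x_def)
      moreover have "restrict x Z = y"
        using y r_id Z by (auto simp: x_def fun_eq_iff PiE_iff extensional_def)
      ultimately show "y \<in> (\<lambda>x. restrict x Z) ` pretzel_solutions n m p" by blast
    qed
  qed
  then have "card (pretzel_solutions n m p) = card (Z \<rightarrow>\<^sub>E ?Zn)" by (rule bij_betw_same_card)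
  also have "\<dots> = n ^ card Z" using Z by (simp add: card_PiE)
  finally show ?thesis .
qed

lemma sum_prod_omit_one:
  fixes p :: "nat \<Rightarrow> int"
  assumes "m > 0"
  shows "(\<Sum>S | S \<subseteq> {..<m} \<and> card S = m - 1. \<Prod>i\<in>S. p i) = (\<Sum>i<m. \<Prod>j\<in>{..<m} - {i}. p j)"
proof -
  have "bij_betw (\<lambda>i. {..<m} - {i}) {..<m} {S. S \<subseteq> {..<m} \<and> card S = m - 1}"
  proof (rule bij_betw_imageI)
    show "inj_on (\<lambda>i. {..<m} - {i}) {..<m}" by (auto simp: inj_on_def)
    show "(\<lambda>i. {..<m} - {i}) ` {..<m} = {S. S \<subseteq> {..<m} \<and> card S = m - 1}"
    proof (intro equalityI subsetI)
      fix S assume "S \<in> {S. S \<subseteq> {..<m} \<and> card S = m - 1}"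
      then have S: "S \<subseteq> {..<m}" "card S = m - 1" by auto
      have "card ({..<m} - S) = 1"
        using S assms by (simp add: card_Diff_subset finite_subset)
      then obtain i where "{..<m} - S = {i}" using card_1_singletonE by blast
      then have "S = {..<m} - {i}" "i < m" using S by blast+
      then show "S \<in> (\<lambda>i. {..<m} - {i}) ` {..<m}" by blast
    qed auto
  qed
  from sum.reindex_bij_betw[OF this, of "prod p"] show ?thesis by simp
qed

text \<open>With \<open>q\<^sub>i = 1/p\<^sub>i\<close> modulo \<open>n\<close>, a solution is given by \<open>x\<^sub>0\<close> and the common value \<open>c\<close> through
  \<open>x\<^sub>i = x\<^sub>0 + c \<Sum>\<^sub>l\<^sub><\<^sub>i q\<^sub>l\<close>.  It closes up around the link if and only if \<open>c \<Sum>q\<^sub>l = 0\<close>, and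
  \<open>h\<close> is a unit times \<open>\<Sum>q\<^sub>l\<close>.\<close>

lemma card_pretzel_solutions_units:
  assumes n: "prime n" and m: "m > 0" and p: "\<forall>i<m. \<not> int n dvd p i"
    and h: "h = (\<Sum>S | S \<subseteq> {..<m} \<and> card S = m - 1. \<Prod>i\<in>S. p i)"
  shows "card (pretzel_solutions n m p) = (if [h = 0] (mod int n) then n\<^sup>2 else n)"
proof -
  let ?Zn = "{0..<int n}"
  have n1: "n > 1" using n prime_gt_1_nat by blast
  have "\<forall>i. \<exists>q. i < m \<longrightarrow> [p i * q = 1] (mod int n)"
    using p n by (metis cong_solve_coprime_int coprime_commute prime_imp_coprime prime_nat_int_transfer)
  then obtain q where q: "\<And>i. i < m \<Longrightarrow> [p i * q i = 1] (mod int n)" by metis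
  define H where "H = (\<Sum>i<m. q i)"
  have "[h = (\<Prod>i<m. p i) * H] (mod int n)"
  proof -
    have "[(\<Prod>j\<in>{..<m} - {i}. p j) = (\<Prod>j<m. p j) * q i] (mod int n)" if "i \<in> {..<m}" for i
    proof -
      have "(\<Prod>j<m. p j) * q i = (\<Prod>j\<in>{..<m} - {i}. p j) * (p i * q i)"
        using that by (subst prod.remove[of _ i]) (simp_all add: algebra_simps)
      moreover have "[(\<Prod>j\<in>{..<m} - {i}. p j) * (p i * q i) = (\<Prod>j\<in>{..<m} - {i}. p j) * 1] (mod int n)"
        using that by (intro cong_mult q) simp_all
      ultimately show ?thesis by (metis cong_sym mult.right_neutral)
    qed
    then have "[(\<Sum>i<m. \<Prod>j\<in>{..<m} - {i}. p j) = (\<Sum>i<m. (\<Prod>j<m. p j) * q i)] (mod int n)"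
      by (rule cong_sum)
    then show ?thesis
      unfolding h sum_prod_omit_one[OF m] H_def sum_distrib_left .
  qed
  moreover have "\<not> int n dvd (\<Prod>i<m. p i)"
    using p n by (subst prime_dvd_prod_iff) auto
  ultimately have hH: "[h = 0] (mod int n) \<longleftrightarrow> int n dvd H"
    using n by (metis cong_0_iff cong_dvd_iff prime_dvd_mult_iff prime_nat_int_transfer)
  \<comment> \<open>The free parameters \<open>x\<^sub>0\<close> and \<open>c\<close> of a solution; \<open>C\<close> holds the values of \<open>c\<close> that close up.\<close>
  define F where "F x = (x 0, (p 0 * (x (Suc 0 mod m) - x 0)) mod int n)" for x :: "nat \<Rightarrow> int"
  define C where "C = {c \<in> ?Zn. int n dvd c * H}"
  have partial: "[x i = x 0 + c * (\<Sum>l<i. q l)] (mod int n)"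
    if "i < m" "\<forall>i. Suc i < m \<longrightarrow> [p i * (x (Suc i) - x i) = c] (mod int n)"
    for x :: "nat \<Rightarrow> int" and i c
    using that(1)
  proof (induction i)
    case (Suc i)
    have "[(p i * q i) * (x (Suc i) - x i) = c * q i] (mod int n)"
      using cong_scalar_right[OF that(2)[rule_format, OF Suc.prems], of "q i"]
      by (simp add: algebra_simps)
    moreover have "[(p i * q i) * (x (Suc i) - x i) = 1 * (x (Suc i) - x i)] (mod int n)"
      using q[of i] Suc.prems by (intro cong_scalar_right) simp
    ultimately have "[x (Suc i) - x i = c * q i] (mod int n)"
      by (metis cong_sym cong_trans mult_1)
    from cong_add[OF this Suc.IH] Suc.prems show ?case by (simp add: algebra_simps)
  qed simp
  have solD: "x i \<in> ?Zn" "[p i * (x (Suc i mod m) - x i) = snd (F x)] (mod int n)"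
    "[x i = x 0 + snd (F x) * (\<Sum>l<i. q l)] (mod int n)"
    if "x \<in> pretzel_solutions n m p" "i < m" for x i
  proof -
    have *: "[p i * (x (Suc i mod m) - x i) = snd (F x)] (mod int n)" if "i < m" for i
      using \<open>x \<in> _\<close> that by (auto simp: pretzel_solutions_def F_def)
    from this[OF that(2)] show "[p i * (x (Suc i mod m) - x i) = snd (F x)] (mod int n)" .
    show "x i \<in> ?Zn" using that by (auto simp: pretzel_solutions_def PiE_iff)
    show "[x i = x 0 + snd (F x) * (\<Sum>l<i. q l)] (mod int n)"
    proof (rule partial[OF that(2)], intro allI impI)
      fix i assume "Suc i < m"
      then show "[p i * (x (Suc i) - x i) = snd (F x)] (mod int n)" using *[of i] by simp
    qed
  qed
  have sub: "pretzel_solutions n m p \<subseteq> {..<m} \<rightarrow>\<^sub>E ?Zn"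
    by (auto simp: pretzel_solutions_def)
  have "bij_betw F (pretzel_solutions n m p) (?Zn \<times> C)"
  proof (rule bij_betw_imageI)
    show "inj_on F (pretzel_solutions n m p)"
    proof (rule inj_onI)
      fix x y assume xy: "x \<in> pretzel_solutions n m p" "y \<in> pretzel_solutions n m p"
        and eq: "F x = F y"
      then have "x 0 = y 0" by (simp add: F_def)
      have "x i = y i" if "i < m" for i
      proof (rule cong_residues_eq[OF _ solD(1)[OF xy(1) that] solD(1)[OF xy(2) that]])
        show "[x i = y i] (mod int n)"
          using solD(3)[OF xy(1) that] solD(3)[OF xy(2) that] eq \<open>x 0 = y 0\<close>
          by (metis cong_sym cong_trans)
      qed
      then show "x = y"
        using xy sub by (intro PiE_ext[of x "{..<m}" "\<lambda>_. ?Zn" y]) auto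
    qed
    show "F ` pretzel_solutions n m p = ?Zn \<times> C"
    proof (intro equalityI subsetI)
      fix w assume "w \<in> F ` pretzel_solutions n m p"
      then obtain x where x: "x \<in> pretzel_solutions n m p" "w = F x" by blast
      define c where "c = snd (F x)"
      \<comment> \<open>The step from the last tangle back to the first one gives the closing condition.\<close>
      obtain l where l: "m = Suc l" using m by (cases m) auto
      have "[p l * (x 0 - x l) * q l = c * q l] (mod int n)"
        using solD(2)[OF x(1), of l] by (intro cong_scalar_right) (simp add: l c_def)
      moreover have "[(p l * q l) * (x 0 - x l) = 1 * (x 0 - x l)] (mod int n)"
        using q[of l] l by (intro cong_scalar_right) simp
      ultimately have "[x 0 - x l = c * q l] (mod int n)"
        by (metis (no_types, opaque_lifting) cong_sym cong_trans mult.assoc mult.commute mult_1)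
      from cong_add[OF this solD(3)[OF x(1), of l]]
      have "[x 0 = x 0 + c * H] (mod int n)"
        by (simp add: l c_def H_def algebra_simps)
      then have "int n dvd c * H"
        by (metis add.right_neutral cong_add_lcancel cong_0_iff cong_sym)
      moreover have "c \<in> ?Zn" using n1 by (simp add: c_def F_def)
      ultimately have "c \<in> C" by (simp add: C_def)
      moreover have "fst w \<in> ?Zn" using solD(1)[OF x(1) m] x(2) by (simp add: F_def)
      ultimately show "w \<in> ?Zn \<times> C" using x(2) c_def by (simp add: mem_Times_iff)
    next
      fix w assume "w \<in> ?Zn \<times> C"
      then obtain a c where w: "w = (a, c)" "a \<in> ?Zn" "c \<in> ?Zn" "int n dvd c * H"
        by (auto simp: C_def)
      define x where "x = (\<lambda>i\<in>{..<m}. (a + c * (\<Sum>l<i. q l)) mod int n)"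
      have x_cong: "[x i = a + c * (\<Sum>l<i. q l)] (mod int n)" if "i < m" for i
        using that by (simp add: x_def)
      have x_next: "[x (Suc i mod m) = a + c * (\<Sum>l<Suc i. q l)] (mod int n)" if "i < m" for i
      proof (cases "Suc i = m")
        case True
        have "[a + c * 0 = a + c * H] (mod int n)"
          using w(4) by (intro cong_add) (simp_all add: cong_0_iff cong_sym)
        then show ?thesis using x_cong[OF m] True by (auto simp: H_def intro: cong_trans)
      next
        case False
        then show ?thesis using x_cong[of "Suc i"] that by simp
      qed
      have c_cong: "[p i * (x (Suc i mod m) - x i) = c] (mod int n)" if "i < m" for i
      proof -
        have "[p i * (x (Suc i mod m) - x i) =
            p i * ((a + c * (\<Sum>l<Suc i. q l)) - (a + c * (\<Sum>l<i. q l)))] (mod int n)"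
          by (intro cong_mult cong_diff x_cong x_next that cong_refl)
        also have "p i * ((a + c * (\<Sum>l<Suc i. q l)) - (a + c * (\<Sum>l<i. q l))) = (p i * q i) * c"
          by (simp add: algebra_simps)
        also have "[(p i * q i) * c = 1 * c] (mod int n)"
          using q[OF that] by (intro cong_scalar_right)
        finally show ?thesis by simp
      qed
      have "x \<in> pretzel_solutions n m p"
        unfolding pretzel_solutions_def
      proof (intro CollectI conjI allI impI)
        show "x \<in> {..<m} \<rightarrow>\<^sub>E ?Zn" using n1 by (auto simp: x_def)
        show "[p i * (x (Suc i mod m) - x i) = p 0 * (x (Suc 0 mod m) - x 0)] (mod int n)"
          if "i < m" for i
          using c_cong[OF that] c_cong[OF m] by (meson cong_sym cong_trans)
      qed
      moreover have "F x = w"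
        using c_cong[OF m] w m by (simp add: F_def cong_def x_def)
      ultimately show "w \<in> F ` pretzel_solutions n m p" by blast
    qed
  qed
  then have "card (pretzel_solutions n m p) = n * card C"
    by (simp add: bij_betw_same_card card_cartesian_product)
  moreover have "card C = (if [h = 0] (mod int n) then n else 1)"
  proof (cases "int n dvd H")
    case True
    then have "C = ?Zn" by (auto simp: C_def)
    then show ?thesis using True hH by simp
  next
    case False
    then have "int n dvd c * H \<longleftrightarrow> int n dvd c" for c
      using n by (simp add: prime_dvd_mult_iff)
    then have "C = {0}"
      using n1 by (auto simp: C_def dest: zdvd_imp_le)
    then show ?thesis using False hH by simp
  qed
  ultimately show ?thesis by (simp add: power2_eq_square)
qed

text \<open>A product that omits one factor vanishes unless that factor is the only divisible one.
  Hence all summands vanish if \<open>Z\<close> has at least two elements, and all but one if \<open>Z\<close> is a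
  singleton.\<close>

lemma sum_prod_omit_one_cong_0_iff:
  fixes p :: "nat \<Rightarrow> int"
  assumes n: "prime n" and Z: "Z = {i. i < m \<and> int n dvd p i}" "Z \<noteq> {}"
  shows "[(\<Sum>i<m. \<Prod>j\<in>{..<m} - {i}. p j) = 0] (mod int n) \<longleftrightarrow> card Z \<noteq> 1"
proof -
  have fin: "finite Z" using Z by simp
  have dvd: "int n dvd (\<Prod>j\<in>{..<m} - {i}. p j)" if "z \<in> Z" "z \<noteq> i" for i z
  proof -
    have "p z dvd (\<Prod>j\<in>{..<m} - {i}. p j)" using that Z by (intro dvd_prodI) auto
    then show ?thesis using that Z by (auto intro: dvd_trans)
  qed
  show ?thesis
  proof (cases "card Z = 1")
    case True
    then obtain z where z: "Z = {z}" using card_1_singletonE by blast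
    have "z < m" using z Z by blast
    then have "(\<Sum>i<m. \<Prod>j\<in>{..<m} - {i}. p j) =
        (\<Prod>j\<in>{..<m} - {z}. p j) + (\<Sum>i\<in>{..<m} - {z}. \<Prod>j\<in>{..<m} - {i}. p j)"
      by (subst sum.remove[of _ z]) auto
    moreover have "int n dvd (\<Sum>i\<in>{..<m} - {z}. \<Prod>j\<in>{..<m} - {i}. p j)"
      using dvd z by (intro dvd_sum) auto
    moreover have "\<not> int n dvd (\<Prod>j\<in>{..<m} - {z}. p j)"
    proof
      assume "int n dvd (\<Prod>j\<in>{..<m} - {z}. p j)"
      then have "\<exists>j\<in>{..<m} - {z}. int n dvd p j" using n by (subst (asm) prime_dvd_prod_iff) auto
      then show False using z Z by blast
    qed
    ultimately show ?thesis using True by (simp add: cong_0_iff dvd_add_left_iff)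
  next
    case False
    have "int n dvd (\<Prod>j\<in>{..<m} - {i}. p j)" for i
    proof -
      have "\<not> Z \<subseteq> {i}" using False Z(2) by (auto simp: subset_singleton_iff)
      then show ?thesis using dvd by blast
    qed
    then show ?thesis using False by (simp add: cong_0_iff dvd_sum)
  qed
qed

lemma card_hom_pretzel:
  assumes n: "prime n" and m: "m > 0" and p: "\<forall>i<m. p i > 0"
    and ori: "is_orientation (pretzel_diagram s m p) ori"
  shows "card (quandle_hom (fundamental_quandle (pretzel_diagram s m p) ori)
    (dihedral_quandle n)) = card (pretzel_solutions n m p)"
proof -
  have nonzero: "\<forall>i<m. p i \<noteq> 0" using p by force
  have "glue (pretzel_diagram s m p) = pretzel_glue m p" by (simp add: pretzel_diagram_def)
  then have "\<forall>e\<in>ends (pretzel_diagram s m p).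
      glue (pretzel_diagram s m p) e \<in> ends (pretzel_diagram s m p) \<and>
      glue (pretzel_diagram s m p) (glue (pretzel_diagram s m p) e) = e"
    using pretzel_glue_involution(1,3)[OF nonzero] by simp
  from card_hom_eq_card_fox_colorings[OF this ori, of n]
    bij_betw_same_card[OF bij_betw_pretzel_solutions[OF prime_gt_0_nat[OF n] m p]]
  show ?thesis by simp
qed

lemma fundamental_quandle_nonempty:
  assumes "c \<in> crossings D"
  obtains x where "x \<in> carrier (fundamental_quandle D I)"
proof -
  have "arc D (c, NW) \<in> arcs D" using assms by (auto simp: arcs_def ends_def)
  then have "Gen (arc D (c, NW)) \<in> qterms (arcs D)" by simp
  from quotientI[OF this] show ?thesis
    using that by (auto simp: fundamental_quandle_def presented_quandle_def)
qed


section \<open>The quivers of pretzel links\<close>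

lemma pseudograph_iso_trans:
  assumes "pseudograph_iso G H" "pseudograph_iso H K"
  shows "pseudograph_iso G K"
proof -
  obtain \<pi> \<rho> where \<pi>: "bij_betw \<pi> (verts G) (verts H)"
    "\<forall>x\<in>verts G. \<forall>y\<in>verts G. weight H (\<pi> x) (\<pi> y) = weight G x y"
    and \<rho>: "bij_betw \<rho> (verts H) (verts K)"
    "\<forall>x\<in>verts H. \<forall>y\<in>verts H. weight K (\<rho> x) (\<rho> y) = weight H x y"
    using assms unfolding pseudograph_iso_def by blast
  have "bij_betw (\<rho> \<circ> \<pi>) (verts G) (verts K)" using \<pi>(1) \<rho>(1) by (rule bij_betw_trans)
  moreover have "weight K ((\<rho> \<circ> \<pi>) x) ((\<rho> \<circ> \<pi>) y) = weight G x y"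
    if "x \<in> verts G" "y \<in> verts G" for x y
    using \<pi> \<rho>(2) that bij_betwE[OF \<pi>(1)] by simp
  ultimately show ?thesis unfolding pseudograph_iso_def by blast
qed

lemma join_left_no_copies: "pseudograph_iso (join_left G c (copies 0 H)) G"
proof -
  have "bij_betw projl (verts G <+> {}) (verts G)"
    by (rule bij_betwI[of _ _ _ Inl]) auto
  then show ?thesis
    unfolding pseudograph_iso_def
    by (intro exI[of _ projl]) (auto simp: join_left_def copies_def)
qed

lemma join_left_one_copy: "pseudograph_iso (join_left G c (copies 1 H)) (join_left G c H)"
proof -
  have "bij_betw (map_sum id snd) (verts G <+> {..<1::nat} \<times> verts H) (verts G <+> verts H)"
    by (rule bij_betwI[of _ _ _ "map_sum id (Pair 0)"]) auto
  then show ?thesis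
    unfolding pseudograph_iso_def
    by (intro exI[of _ "map_sum id snd"]) (auto simp: join_left_def copies_def)
qed

theorem theorem30:
  fixes n m :: nat and p :: "nat \<Rightarrow> int" and h :: int
    and s :: slope and ori :: "((nat \<times> nat) \<times> corner) set"
  assumes n: "prime n"
    and m: "m > 0"
    and p: "\<forall>i<m. p i > 0"
    and ori: "is_orientation (pretzel_diagram s m p) ori"
    and h: "h = (\<Sum>S | S \<subseteq> {..<m} \<and> card S = m - 1. \<Prod>i\<in>S. p i)"
    and Quiver: "Quiver = coloring_quiver (dihedral_quandle n) (pretzel_diagram s m p) ori"
  shows "(\<not> [h = 0] (mod int n) \<longrightarrow> pseudograph_iso Quiver (complete_graph n n))
    \<and> ([h = 0] (mod int n) \<and>
         \<not> (\<forall>S. S \<subseteq> {..<m} \<and> card S + 2 = m \<longrightarrow> [(\<Prod>i\<in>S. p i) = 0] (mod int n)) \<longrightarrow>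
         pseudograph_iso Quiver
           (join_left (complete_graph n n) 1 (complete_graph ((n - 1) * n) 1)))
    \<and> (\<forall>j. 2 \<le> j \<and> j + 3 \<le> m \<and> [h = 0] (mod int n) \<and>
           card {i. i < m \<and> coprime (p i) (int n)} = j \<and>
           (\<forall>i<m. \<not> coprime (p i) (int n) \<longrightarrow> int n dvd p i) \<longrightarrow>
         pseudograph_iso Quiver
           (join_left (complete_graph n n) 1
             (copies ((n ^ (m - j) - n) div (n * (n - 1))) (complete_graph (n * (n - 1)) 1))))
    \<and> (card {i. i < m \<and> coprime (p i) (int n)} = 1 \<longrightarrow>
         pseudograph_iso Quiver
           (join_left (complete_graph n n) 1
             (copies ((n ^ (m - 1) - n) div (n * (n - 1))) (complete_graph (n * (n - 1)) 1))))
    \<and> ((\<forall>i<m. [p i = 0] (mod int n)) \<longrightarrow>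
         pseudograph_iso Quiver
           (join_left (complete_graph n n) 1
             (copies ((n ^ m - n) div (n * (n - 1))) (complete_graph (n * (n - 1)) 1))))"
proof -
  define D where "D = pretzel_diagram s m p"
  define V where "V = quandle_hom (fundamental_quandle D ori) (dihedral_quandle n)"
  define Z where "Z = {i. i < m \<and> int n dvd p i}"
  define U where "U = {i. i < m \<and> coprime (p i) (int n)}"
  let ?G = "\<lambda>q. join_left (complete_graph n n) 1 (copies q (complete_graph (n * (n - 1)) 1))"
  have n1: "n > 1" using n prime_gt_1_nat by blast
  have finZ: "finite Z" by (simp add: Z_def)
  have U: "U = {..<m} - Z"
  proof -
    have "coprime (p i) (int n) \<longleftrightarrow> \<not> int n dvd p i" for i
    proof
      show "coprime (p i) (int n) \<Longrightarrow> \<not> int n dvd p i"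
        using n1 coprime_common_divisor[of "p i" "int n" "int n"] by auto
      show "\<not> int n dvd p i \<Longrightarrow> coprime (p i) (int n)"
        using n prime_imp_coprime[of "int n" "p i"] by (simp add: coprime_commute)
    qed
    then show ?thesis by (auto simp: U_def Z_def)
  qed
  have Zm: "Z \<subseteq> {..<m}" by (auto simp: Z_def)
  then have cardU: "card U = m - card Z" and cardZ: "card Z \<le> m"
    using finZ card_mono[OF _ Zm] by (simp_all add: U card_Diff_subset)
  have h': "h = (\<Sum>i<m. \<Prod>j\<in>{..<m} - {i}. p j)" unfolding h by (rule sum_prod_omit_one[OF m])
  have cardV: "card V = card (pretzel_solutions n m p)"
    unfolding V_def D_def by (rule card_hom_pretzel[OF n m p ori])
  have empty: "card V = (if [h = 0] (mod int n) then n\<^sup>2 else n)" if "Z = {}"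
    unfolding cardV using that by (intro card_pretzel_solutions_units[OF n m _ h]) (auto simp: Z_def)
  have nonempty: "card V = n ^ card Z" "[h = 0] (mod int n) \<longleftrightarrow> card Z \<noteq> 1" if "Z \<noteq> {}"
    using card_pretzel_solutions_vanishing[OF n Z_def that]
      sum_prod_omit_one_cong_0_iff[OF n Z_def that] by (simp_all add: cardV h')
  \<comment> \<open>The count is positive, and an infinite set would have cardinality zero.\<close>
  have fin: "finite V"
    using empty nonempty n1 by (cases "Z = {}") (auto intro: card_ge_0_finite split: if_splits)
  have "(0, 0) \<in> crossings D" using m p[rule_format, OF m] by (simp add: D_def pretzel_diagram_def)
  then obtain x where x: "x \<in> carrier (fundamental_quandle D ori)"
    by (rule fundamental_quandle_nonempty)
  have "is_quandle (fundamental_quandle D ori)"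
    unfolding fundamental_quandle_def by (rule is_quandle_presented)
  from dihedral_quiver_iso[OF n this x, folded V_def, OF fin]
  have iso: "pseudograph_iso Quiver (?G ((card V - n) div (n * (n - 1))))"
    by (simp only: Quiver coloring_quiver_def flip: V_def D_def)
  show ?thesis
    unfolding U_def[symmetric]
  proof (intro conjI impI allI)
    assume h0: "\<not> [h = 0] (mod int n)"
    then have "card V = n" using empty nonempty by (cases "Z = {}") auto
    then have "pseudograph_iso Quiver (?G 0)" using iso by simp
    then show "pseudograph_iso Quiver (complete_graph n n)"
      using join_left_no_copies by (rule pseudograph_iso_trans)
  next
    assume "[h = 0] (mod int n) \<and>
      \<not> (\<forall>S. S \<subseteq> {..<m} \<and> card S + 2 = m \<longrightarrow> [(\<Prod>i\<in>S. p i) = 0] (mod int n))"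
    then obtain S where h0: "[h = 0] (mod int n)" and S: "S \<subseteq> {..<m}" "card S + 2 = m"
      "\<not> int n dvd (\<Prod>i\<in>S. p i)"
      by (auto simp: cong_0_iff)
    \<comment> \<open>The nonvanishing product of \<open>m - 2\<close> factors allows at most two divisible parameters, and
    \<open>h = 0\<close> excludes exactly one.  The remaining numbers, none and two, both give \<open>n\<^sup>2\<close>.\<close>
    have finS: "finite S" using S(1) finite_subset by blast
    have "Z \<subseteq> {..<m} - S"
      using S(3) finS by (auto simp: Z_def intro: dvd_trans dvd_prodI)
    from card_mono[OF _ this] have "card Z \<le> 2" using S finS by (simp add: card_Diff_subset)
    then have "card V = n\<^sup>2"
    proof (cases "Z = {}")
      case False
      then have "card Z \<noteq> 0" "card Z \<noteq> 1" using finZ nonempty(2) h0 by simp_all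
      with \<open>card Z \<le> 2\<close> have "card Z = 2" by simp
      then show ?thesis using nonempty(1)[OF False] by simp
    qed (use empty h0 in simp)
    then have "card V - n = n * (n - 1)" by (simp add: power2_eq_square diff_mult_distrib2)
    then have "pseudograph_iso Quiver (?G 1)" using iso n1 by simp
    then have "pseudograph_iso Quiver
        (join_left (complete_graph n n) 1 (complete_graph (n * (n - 1)) 1))"
      using join_left_one_copy by (rule pseudograph_iso_trans)
    then show "pseudograph_iso Quiver
        (join_left (complete_graph n n) 1 (complete_graph ((n - 1) * n) 1))"
      by (simp add: mult.commute)
  next
    fix j
    assume *: "2 \<le> j \<and> j + 3 \<le> m \<and> [h = 0] (mod int n) \<and> card U = j \<and>
      (\<forall>i<m. \<not> coprime (p i) (int n) \<longrightarrow> int n dvd p i)"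
    then have "card Z = m - j" "Z \<noteq> {}" using cardU cardZ by auto
    then show "pseudograph_iso Quiver (?G ((n ^ (m - j) - n) div (n * (n - 1))))"
      using iso nonempty(1) by simp
  next
    assume *: "card U = 1"
    show "pseudograph_iso Quiver (?G ((n ^ (m - 1) - n) div (n * (n - 1))))"
    proof (cases "Z = {}")
      case True
      \<comment> \<open>For \<open>m = 1\<close> the only colorings are the constant ones, and truncated subtraction
      \<open>1 - n = 0\<close> makes the number of copies zero.\<close>
      then have "m = 1" using * cardU by simp
      then have "h = 1" using h' by (simp add: lessThan_Suc)
      then have "card V - n = 0" "n ^ (m - 1) - n = 0"
        using empty[OF True] n1 \<open>m = 1\<close> by (simp_all add: cong_0_iff)
      then show ?thesis using iso by simp
    next
      case False
      have "card Z = m - 1" using * cardU by simp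
      then show ?thesis using iso nonempty(1)[OF False] by simp
    qed
  next
    assume "\<forall>i<m. [p i = 0] (mod int n)"
    then have "Z = {..<m}" by (auto simp: Z_def cong_0_iff)
    then have "card Z = m" "Z \<noteq> {}" using m by auto
    then show "pseudograph_iso Quiver (?G ((n ^ m - n) div (n * (n - 1))))"
      using iso nonempty(1) by simp
  qed
qed

end
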